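(* Let $Z \subset \R^d$ be a $d$-dimensional zonotope with lattice of flats $\mathcal{L} = \mathcal{L}(Z)$. If $\alpha$ is any cone angle, then \[ \check{\alpha}_i(Z) \ = \ W_{i}(\mathcal{L}(Z)) \quad \text{ and } \quad \widehat{\alpha}_i(Z) \ = \ (-1)^{d-i} w_{d-i}(\mathcal{L}(Z)^\mathrm{op}) \] for all $i=0,\dots,d-1$.
   Context: A cone angle is a map $\alpha$ from the set $\mathcal{C}_d$ of polyhedral cones in $\R^d$ with apex at the origin to $\R$ with $\alpha(\{0\})=0$, $\alpha(C\cup C') = \alpha(C)+\alpha(C')-\alpha(C\cap C')$ whenever $C\cup C', C\cap C' \in \mathcal{C}_d$, $\alpha(C)=0$ whenever $\dim C<d$, and $\alpha(\R^d)=1$. For a full-dimensional polytope $P$ and a face $F$, the interior angle is $\widehat{\alpha}(F,P) = \alpha(\mathrm{T}_F P)$, where $\mathrm{T}_F P = \mathrm{cone}(-q+P)$ for $q$ in the relative interior of $F$; the exterior angle is $\check{\alpha}(F,P) = \alpha(\mathrm{N}_F P + \mathsf{L}(F))$, where $\mathrm{N}_F P = \{c : \langle c,x\rangle \ge \langle c,y\rangle \text{ for all } x\in F, y \in P\}$ is the normal cone and $\mathsf{L}(F)$ is the linear subspace parallel to the affine hull of $F$. Then $\widehat{\alpha}_i(P)$ and $\check{\alpha}_i(P)$ are the sums of $\widehat{\alpha}(F,P)$, resp. $\check{\alpha}(F,P)$, over all $i$-dimensional faces $F$. The lattice of flats $\mathcal{L}(P) = \{\mathsf{L}(F) : \emptyset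 \neq F \subseteq P\}$ is ordered by inclusion (minimum $\{0\}$, maximum $\mathsf{L}(P)$); $\mathcal{L}^\mathrm{op}$ is the same set ordered by reverse inclusion. For a graded poset with minimum $\mathbf{0}$, $W_i$ is the number of elements of rank $i$ and $w_i = \sum_{a : \mathrm{rk}(a) = i} \mu(\mathbf{0},a)$, with $\mu$ the Möbius function. *)

theory Defs
  imports "HOL-Analysis.Analysis"
begin

section \<open>Posets\<close>

text \<open>
  A poset is given by its order relation \<^term>\<open>r\<close> (with \<^prop>\<open>Partial_order r\<close>); its ground set
  is \<^term>\<open>Field r\<close> and the opposite poset is \<^term>\<open>r\<inverse>\<close>.
\<close>

definition poset_bot :: "'b rel \<Rightarrow> 'b"
  where "poset_bot r = (THE z. z \<in> Field r \<and> (\<forall>a\<in>Field r. (z, a) \<in> r))"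

text \<open>
  The rank is the length (number of elements minus one) of a longest chain in the principal
  ideal below \<open>a\<close>. In a graded poset with minimum this is the common length of all maximal chains
  from the minimum to \<open>a\<close>; see the lemma \<open>poset_rank_eqI\<close>.
\<close>

definition poset_rank :: "'b rel \<Rightarrow> 'b \<Rightarrow> nat"
  where "poset_rank r a = Max ((\<lambda>C. card C - 1) ` {C \<in> Chains r. C \<subseteq> under r a})"

text \<open>
  The usual recursion for the Moebius function. The guard is needed only for termination; the
  value is the junk value 0 if \<open>r\<close> is not a finite partial order or \<open>(a, b)\<close> is not in \<open>r\<close>.
\<close>

function moebius :: "'b rel \<Rightarrow> 'b \<Rightarrow> 'b \<Rightarrow> int"
  where "moebius r a b =
    (if finite (Field r) \<and> Partial_order r \<and> (a, b) \<in> r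
     then if a = b then 1 else - (\<Sum>c\<in>{c. (a, c) \<in> r \<and> (c, b) \<in> r \<and> c \<noteq> b}. moebius r a c)
     else 0)"
  by pat_completeness auto
termination
proof (relation "Wellfounded.measure (\<lambda>(r, a, b). card (under r b))", goal_cases)
  case 1
  then show ?case by simp
next
  case (2 r a b c)
  then have po: "Partial_order r" and fin: "finite (Field r)"
    and cb: "(c, b) \<in> r" and ne: "c \<noteq> b"
    by auto
  have tr: "trans r" and an: "antisym r" and rf: "refl_on (Field r) r"
    using po by (auto simp: partial_order_on_def preorder_on_def)
  have "under r c \<subseteq> under r b"
    using tr cb by (auto simp: under_def dest: transD)
  moreover have "b \<in> under r b"
    using rf cb by (auto simp: under_def refl_on_def Field_def)
  moreover have "b \<notin> under r c"
    using an cb ne by (auto simp: under_def dest: antisymD)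
  ultimately have "under r c \<subset> under r b"
    by blast
  moreover have "finite (under r b)"
    by (rule finite_subset[OF _ fin]) (auto simp: under_def Field_def)
  ultimately show ?case
    by (simp add: psubset_card_mono)
qed

declare moebius.simps [simp del]

definition whitney_second :: "'b rel \<Rightarrow> nat \<Rightarrow> nat"
  where "whitney_second r i = card {a \<in> Field r. poset_rank r a = i}"

definition whitney_first :: "'b rel \<Rightarrow> nat \<Rightarrow> int"
  where "whitney_first r i = (\<Sum>a\<in>{a \<in> Field r. poset_rank r a = i}. moebius r (poset_bot r) a)"

lemma poset_rank_eqI:
  fixes r :: "'b rel" and n :: nat
  assumes fin: "finite (Field r)" and po: "Partial_order r" and a: "a \<in> Field r"
    and graded: "\<And>C. \<lbrakk>C \<in> Chains r; C \<subseteq> under r a;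
        \<And>D. \<lbrakk>D \<in> Chains r; D \<subseteq> under r a; C \<subseteq> D\<rbrakk> \<Longrightarrow> D = C\<rbrakk> \<Longrightarrow> card C = Suc n"
  shows "poset_rank r a = n"
proof -
  let ?S = "{C \<in> Chains r. C \<subseteq> under r a}"
  have finu: "finite (under r a)"
    by (rule finite_subset[OF _ fin]) (auto simp: under_def Field_def)
  then have finS: "finite ?S"
    by (auto intro: finite_subset[of _ "Pow (under r a)"])
  have max: "\<exists>M\<in>?S. C \<subseteq> M \<and> (\<forall>D\<in>?S. M \<subseteq> D \<longrightarrow> D = M)" if C: "C \<in> ?S" for C
  proof -
    obtain M where "M \<in> ?S" "C \<subseteq> M" "\<forall>D\<in>?S. M \<subseteq> D \<longrightarrow> M = D"
      using finite_has_maximal2[OF finS C] by (elim bexE conjE)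
    then show ?thesis
      by (intro bexI[of _ M]) auto
  qed
  have card_max: "card M = Suc n" if "M \<in> ?S" "\<forall>D\<in>?S. M \<subseteq> D \<longrightarrow> D = M" for M
    using graded[of M] that by auto
  have "card C - 1 \<le> n" if C: "C \<in> ?S" for C
  proof -
    obtain M where M: "M \<in> ?S" "C \<subseteq> M" "\<forall>D\<in>?S. M \<subseteq> D \<longrightarrow> D = M"
      using max[OF C] by blast
    have "card C \<le> card M"
      using M finu by (intro card_mono) (auto intro: finite_subset)
    then show ?thesis
      using card_max[OF M(1,3)] by simp
  qed
  moreover have "n \<in> (\<lambda>C. card C - 1) ` ?S"
  proof -
    have "{} \<in> ?S"
      by (simp add: Chains_def)
    then obtain M where M: "M \<in> ?S" "\<forall>D\<in>?S. M \<subseteq> D \<longrightarrow> D = M"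
      using max by blast
    have "n = card M - 1"
      using card_max[OF M] by simp
    then show ?thesis
      using M(1) by (rule image_eqI)
  qed
  ultimately show ?thesis
    unfolding poset_rank_def using finS by (intro Max_eqI) auto
qed


section \<open>Cone angles\<close>

definition polyhedral_cone :: "'a::euclidean_space set \<Rightarrow> bool"
  where "polyhedral_cone C \<longleftrightarrow> polyhedron C \<and> convex_cone C"

definition cone_angle :: "('a::euclidean_space set \<Rightarrow> real) \<Rightarrow> bool"
  where "cone_angle \<alpha> \<longleftrightarrow>
    \<alpha> {0} = 0 \<and>
    (\<forall>C C'. polyhedral_cone C \<and> polyhedral_cone C' \<and>
        polyhedral_cone (C \<union> C') \<and> polyhedral_cone (C \<inter> C') \<longrightarrow>
        \<alpha> (C \<union> C') = \<alpha> C + \<alpha> C' - \<alpha> (C \<inter> C')) \<and>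
    (\<forall>C. polyhedral_cone C \<and> aff_dim C < int DIM('a) \<longrightarrow> \<alpha> C = 0) \<and>
    \<alpha> UNIV = 1"


section \<open>Interior and exterior angles of polytopes\<close>

definition tangent_cone :: "'a::euclidean_space set \<Rightarrow> 'a set \<Rightarrow> 'a set"
  where "tangent_cone F P =
    (let q = SOME q. q \<in> rel_interior F in convex_cone hull ((\<lambda>x. - q + x) ` P))"

definition normal_cone :: "'a::euclidean_space set \<Rightarrow> 'a set \<Rightarrow> 'a set"
  where "normal_cone F P = {c. \<forall>x\<in>F. \<forall>y\<in>P. c \<bullet> x \<ge> c \<bullet> y}"

definition lin_space :: "'a::euclidean_space set \<Rightarrow> 'a set"
  where "lin_space F = {x - y | x y. x \<in> affine hull F \<and> y \<in> affine hull F}"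

definition interior_angle :: "('a::euclidean_space set \<Rightarrow> real) \<Rightarrow> 'a set \<Rightarrow> 'a set \<Rightarrow> real"
  where "interior_angle \<alpha> F P = \<alpha> (tangent_cone F P)"

text \<open>The sum of sets below is the Minkowski sum.\<close>

definition exterior_angle :: "('a::euclidean_space set \<Rightarrow> real) \<Rightarrow> 'a set \<Rightarrow> 'a set \<Rightarrow> real"
  where "exterior_angle \<alpha> F P = \<alpha> (normal_cone F P + lin_space F)"

definition interior_angle_sum :: "('a::euclidean_space set \<Rightarrow> real) \<Rightarrow> nat \<Rightarrow> 'a set \<Rightarrow> real"
  where "interior_angle_sum \<alpha> i P =
    (\<Sum>F\<in>{F. F face_of P \<and> aff_dim F = int i}. interior_angle \<alpha> F P)"

definition exterior_angle_sum :: "('a::euclidean_space set \<Rightarrow> real) \<Rightarrow> nat \<Rightarrow> 'a set \<Rightarrow> real"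
  where "exterior_angle_sum \<alpha> i P =
    (\<Sum>F\<in>{F. F face_of P \<and> aff_dim F = int i}. exterior_angle \<alpha> F P)"

lemma lin_space_parallel:
  fixes F :: "'a::euclidean_space set"
  assumes "F \<noteq> {}"
  shows "subspace (lin_space F)" and "affine_parallel (affine hull F) (lin_space F)"
proof -
  obtain a where a: "a \<in> affine hull F"
    using assms hull_subset by fastforce
  have sub: "subspace ((\<lambda>x. x - a) ` (affine hull F))"
    using a by (simp add: affine_diffs_subspace_subtract)
  have eq: "lin_space F = (\<lambda>x. x - a) ` (affine hull F)"
  proof
    show "lin_space F \<subseteq> (\<lambda>x. x - a) ` (affine hull F)"
    proof
      fix z assume "z \<in> lin_space F"
      then obtain x y where xy: "x \<in> affine hull F" "y \<in> affine hull F" "z = x - y"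
        by (auto simp: lin_space_def)
      have "(x - a) - (y - a) \<in> (\<lambda>x. x - a) ` (affine hull F)"
        using subspace_diff[OF sub] xy by blast
      then show "z \<in> (\<lambda>x. x - a) ` (affine hull F)"
        using xy by simp
    qed
  qed (use a in \<open>auto simp: lin_space_def\<close>)
  show "subspace (lin_space F)"
    using sub eq by simp
  show "affine_parallel (affine hull F) (lin_space F)"
    unfolding affine_parallel_def eq by (intro exI[of _ "- a"]) simp
qed

lemma convex_cone_hull_translate_le:
  fixes F P :: "'a::euclidean_space set"
  assumes "F \<subseteq> P" "convex F" "q \<in> rel_interior F" "p \<in> F"
  shows "convex_cone hull ((\<lambda>x. - p + x) ` P) \<subseteq> convex_cone hull ((\<lambda>x. - q + x) ` P)"
    (is "_ \<subseteq> ?K")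
proof (rule hull_minimal)
  have K: "convex_cone ?K"
    by (rule convex_cone_convex_cone_hull)
  have in_K: "- q + y \<in> ?K" if "y \<in> P" for y
    using that by (simp add: hull_inc)
  obtain e where e: "e > 1" "(1 - e) *\<^sub>R p + e *\<^sub>R q \<in> F"
    using convex_rel_interior_iff[of F q] assms by blast
  have "- q + ((1 - e) *\<^sub>R p + e *\<^sub>R q) \<in> ?K"
    using e assms in_K by blast
  then have "(1 / (e - 1)) *\<^sub>R (- q + ((1 - e) *\<^sub>R p + e *\<^sub>R q)) \<in> ?K"
    using K e by (intro convex_cone_scaleR) auto
  moreover have "- q + ((1 - e) *\<^sub>R p + e *\<^sub>R q) = (e - 1) *\<^sub>R (q - p)"
    by (simp add: algebra_simps)
  ultimately have "q - p \<in> ?K"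
    using e by simp
  then have "(- q + y) + (q - p) \<in> ?K" if "y \<in> P" for y
    using convex_cone_add[OF K in_K[OF that]] by blast
  moreover have "(- q + y) + (q - p) = - p + y" for y
    by simp
  ultimately have "- p + y \<in> ?K" if "y \<in> P" for y
    using that by metis
  then show "(\<lambda>x. - p + x) ` P \<subseteq> ?K"
    by blast
  show "convex_cone ?K"
    by (rule K)
qed

lemma tangent_cone_eq:
  fixes F P :: "'a::euclidean_space set"
  assumes "F \<subseteq> P" "convex F" "q \<in> rel_interior F"
  shows "tangent_cone F P = convex_cone hull ((\<lambda>x. - q + x) ` P)"
proof -
  let ?p = "SOME p. p \<in> rel_interior F"
  have p: "?p \<in> rel_interior F"
    using assms(3) by (rule someI)
  have "?p \<in> F" "q \<in> F"
    using p assms(3) rel_interior_subset by blast+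
  then show ?thesis
    unfolding tangent_cone_def Let_def using assms p
    by (intro subset_antisym convex_cone_hull_translate_le)
qed


section \<open>Zonotopes and the lattice of flats\<close>

definition zonotope :: "'a::euclidean_space set \<Rightarrow> bool"
  where "zonotope Z \<longleftrightarrow> (\<exists>(m::nat) a b. Z = (\<Sum>k<m. closed_segment (a k) (b k)))"

definition flats :: "'a::euclidean_space set \<Rightarrow> 'a set set"
  where "flats P = {lin_space F | F. F face_of P \<and> F \<noteq> {}}"

definition lattice_of_flats :: "'a::euclidean_space set \<Rightarrow> 'a set rel"
  where "lattice_of_flats P = {(U, V). U \<in> flats P \<and> V \<in> flats P \<and> U \<subseteq> V}"

end

theory Submission
  imports Defs
begin

text \<open>
  A cone angle is additive under cutting by hyperplanes and ignores lower-dimensional cones, so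
  every linear relation between indicator functions of polyhedral cones that holds almost
  everywhere also holds between their angles.

  A zonotope is a belt polytope: its normal fan is the fan of a central hyperplane arrangement,
  since the normal fan of a Minkowski sum is the common refinement of the normal fans of the
  summands. The flats of a belt polytope are the spans of sets of normals of the arrangement, and
  for a flat \<open>U\<close> the open normal cones of the faces \<open>F\<close> with \<open>U \<subseteq> L(F)\<close> partition \<open>U\<^sup>\<bottom>\<close>.

  The cones \<open>N_F + U\<close> of the faces \<open>F\<close> with \<open>L(F) = U\<close> tile the space up to a null set, so their
  angles add up to 1. For the interior angles let \<open>U\<close> be a proper flat and \<open>x\<close> generic. Then \<open>U\<^sup>\<bottom>\<close>
  and its open half \<open>{c \<in> U\<^sup>\<bottom>. x \<bullet> c > 0}\<close> have the same Euler characteristic with compact supports.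
  Decompose both into pieces of open normal cones: the difference only retains the cones that miss
  the half, and these belong to the faces \<open>F\<close> with \<open>x \<in> T_F\<close>. So the signed number of faces \<open>F\<close> with
  \<open>U \<subseteq> L(F)\<close> and \<open>x \<in> T_F\<close> vanishes, and the resulting relation between angles is the recursion for
  the Moebius function of the opposite lattice of flats.
\<close>

section \<open>Cone angles as simple valuations\<close>

lemma convex_cone_bounded_inner_nonpos:
  assumes "convex_cone C" and bound: "\<And>x. x \<in> C \<Longrightarrow> a \<bullet> x \<le> b" and "x \<in> C"
  shows "a \<bullet> x \<le> 0"
proof (rule ccontr)
  assume "\<not> a \<bullet> x \<le> 0"
  then have inner_pos: "a \<bullet> x > 0" by simp
  define t where "t = (\<bar>b\<bar> + 1) / (a \<bullet> x)"
  have "t *\<^sub>R x \<in> C"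
    using assms(1,3) inner_pos by (intro convex_cone_scaleR) (auto simp: t_def)
  then have "a \<bullet> (t *\<^sub>R x) \<le> b"
    by (rule bound)
  then show False
    using inner_pos by (simp add: t_def)
qed

lemma polyhedral_cone_iff:
  fixes C :: "'a::euclidean_space set"
  shows "polyhedral_cone C \<longleftrightarrow> (\<exists>N. finite N \<and> C = {x. \<forall>a\<in>N. a \<bullet> x \<le> 0})"
proof
  assume "polyhedral_cone C"
  then have "polyhedron C" and cone: "convex_cone C"
    by (auto simp: polyhedral_cone_def)
  then obtain H a b where "finite H" and C_eq: "C = \<Inter>H"
    and halfspace: "\<forall>h\<in>H. h = {x. a h \<bullet> x \<le> b h}"
    unfolding polyhedron_def by metis
  have mem_C_iff: "x \<in> C \<longleftrightarrow> (\<forall>h\<in>H. a h \<bullet> x \<le> b h)" for x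
    unfolding C_eq using halfspace by blast
  have "a h \<bullet> x \<le> 0" if "x \<in> C" "h \<in> H" for x h
    using cone mem_C_iff that by (intro convex_cone_bounded_inner_nonpos[of C _ "b h"]) auto
  moreover have "x \<in> C" if "\<forall>h\<in>H. a h \<bullet> x \<le> 0" for x
  proof -
    have "0 \<le> b h" if "h \<in> H" for h
      using mem_C_iff[of 0] that convex_cone_contains_0[OF cone] by simp
    then show ?thesis
      unfolding mem_C_iff using that by (meson order_trans)
  qed
  ultimately have "C = {x. \<forall>v\<in>a ` H. v \<bullet> x \<le> 0}"
    by auto
  with \<open>finite H\<close> show "\<exists>N. finite N \<and> C = {x. \<forall>a\<in>N. a \<bullet> x \<le> 0}"
    by blast
next
  assume "\<exists>N. finite N \<and> C = {x. \<forall>a\<in>N. a \<bullet> x \<le> 0}"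
  then obtain N where "finite N" and C_eq: "C = (\<Inter>a\<in>N. {x. a \<bullet> x \<le> 0})"
    by blast
  then show "polyhedral_cone C"
    unfolding polyhedral_cone_def C_eq
    by (auto intro!: polyhedron_Inter polyhedron_halfspace_le convex_cone_Inter
        convex_cone_halfspace_le)
qed

lemma polyhedral_cone_halfspace_le: "polyhedral_cone {x. a \<bullet> x \<le> 0}"
  and polyhedral_cone_halfspace_ge: "polyhedral_cone {x. a \<bullet> x \<ge> 0}"
  for a :: "'a::euclidean_space"
  by (simp_all add: polyhedral_cone_def polyhedron_halfspace_le polyhedron_halfspace_ge
      convex_cone_halfspace_le convex_cone_halfspace_ge)

lemma polyhedral_cone_UNIV: "polyhedral_cone UNIV"
  by (simp add: polyhedral_cone_def convex_cone_iff)

lemma polyhedral_cone_Int: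
  "polyhedral_cone C \<Longrightarrow> polyhedral_cone D \<Longrightarrow> polyhedral_cone (C \<inter> D)"
  by (auto simp: polyhedral_cone_def convex_cone_iff)

lemma cone_angle_empty_interior:
  fixes \<alpha> :: "'a::euclidean_space set \<Rightarrow> real"
  assumes "cone_angle \<alpha>" "polyhedral_cone C" "interior C = {}"
  shows "\<alpha> C = 0"
proof -
  have "convex C" "C \<noteq> {}"
    using assms(2) by (auto simp: polyhedral_cone_def convex_cone_def)
  then have "aff_dim C \<noteq> int DIM('a)"
    using assms(3) by (metis aff_dim_eq_full rel_interior_eq_empty rel_interior_interior)
  then have "aff_dim C < int DIM('a)"
    using aff_dim_le_DIM[of C] by simp
  then show ?thesis
    using assms(1,2) by (simp add: cone_angle_def)
qed

lemma cone_angle_subset_hyperplane: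
  fixes \<alpha> :: "'a::euclidean_space set \<Rightarrow> real"
  assumes "cone_angle \<alpha>" "polyhedral_cone C" "C \<subseteq> {x. a \<bullet> x = 0}" "a \<noteq> 0"
  shows "\<alpha> C = 0"
  using interior_mono[OF assms(3)] interior_hyperplane[OF assms(4)]
  by (intro cone_angle_empty_interior[OF assms(1,2)]) simp

lemma cone_angle_split:
  fixes \<alpha> :: "'a::euclidean_space set \<Rightarrow> real"
  assumes angle: "cone_angle \<alpha>" and cone: "polyhedral_cone C" and "a \<noteq> 0"
  shows "\<alpha> C = \<alpha> (C \<inter> {x. a \<bullet> x \<le> 0}) + \<alpha> (C \<inter> {x. a \<bullet> x \<ge> 0})"
proof -
  let ?L = "C \<inter> {x. a \<bullet> x \<le> 0}" and ?R = "C \<inter> {x. a \<bullet> x \<ge> 0}"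
  have parts: "polyhedral_cone ?L" "polyhedral_cone ?R"
    by (simp_all add: cone polyhedral_cone_Int polyhedral_cone_halfspace_le
        polyhedral_cone_halfspace_ge)
  have union: "?L \<union> ?R = C" by auto
  have "polyhedral_cone (?L \<union> ?R)"
    unfolding union by (rule cone)
  then have "\<alpha> (?L \<union> ?R) = \<alpha> ?L + \<alpha> ?R - \<alpha> (?L \<inter> ?R)"
    using angle parts polyhedral_cone_Int[OF parts] unfolding cone_angle_def by blast
  moreover have "\<alpha> (?L \<inter> ?R) = 0"
    by (rule cone_angle_subset_hyperplane[OF angle polyhedral_cone_Int[OF parts] _ \<open>a \<noteq> 0\<close>]) auto
  ultimately show ?thesis
    using union by simp
qed

definition one_sided :: "'a::real_inner set \<Rightarrow> 'a \<Rightarrow> bool"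
  where "one_sided D a \<longleftrightarrow> D \<subseteq> {x. a \<bullet> x \<le> 0} \<or> D \<subseteq> {x. a \<bullet> x \<ge> 0}"

lemma one_sided_subset: "one_sided D a \<Longrightarrow> E \<subseteq> D \<Longrightarrow> one_sided E a"
  unfolding one_sided_def by blast

lemma cone_functional_eq_0_if_one_sided:
  fixes f :: "'a::euclidean_space set \<Rightarrow> real"
  assumes "finite A" "0 \<notin> A"
    and split: "\<And>D a. \<lbrakk>polyhedral_cone D; a \<noteq> 0\<rbrakk>
      \<Longrightarrow> f D = f (D \<inter> {x. a \<bullet> x \<le> 0}) + f (D \<inter> {x. a \<bullet> x \<ge> 0})"
    and "\<And>D. \<lbrakk>polyhedral_cone D; \<forall>a\<in>A. one_sided D a\<rbrakk> \<Longrightarrow> f D = 0"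
    and "polyhedral_cone D"
  shows "f D = 0"
  using assms(1,2,4,5)
proof (induction A arbitrary: D rule: finite_induct)
  case empty
  then show ?case by simp
next
  case (insert a A)
  have vanish: "f E = 0" if E: "polyhedral_cone E" "\<forall>b\<in>A. one_sided E b" for E
  proof -
    have "f (E \<inter> {x. a \<bullet> x \<le> 0}) = 0" "f (E \<inter> {x. a \<bullet> x \<ge> 0}) = 0"
      using E by (auto simp: one_sided_def[of _ a] polyhedral_cone_Int polyhedral_cone_halfspace_le
          polyhedral_cone_halfspace_ge intro!: insert.prems(2)
          intro: one_sided_subset[OF _ Int_lower1])
    then show ?thesis
      using split[OF E(1), of a] insert.prems(1) by simp
  qed
  show ?case
    by (rule insert.IH[OF _ vanish insert.prems(3)]) (use insert.prems(1) in auto)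
qed

lemma cone_angle_Int_one_sided:
  fixes \<alpha> :: "'a::euclidean_space set \<Rightarrow> real"
  assumes angle: "cone_angle \<alpha>" and normals: "finite N" "C = {x. \<forall>a\<in>N. a \<bullet> x \<le> 0}"
    and piece: "polyhedral_cone D" "\<forall>a\<in>N - {0}. one_sided D a"
    and point: "p \<in> D" "\<forall>a\<in>N - {0}. a \<bullet> p \<noteq> 0"
  shows "\<alpha> (C \<inter> D) = indicator C p * \<alpha> D"
proof (cases "p \<in> C")
  case True
  have "D \<subseteq> {x. a \<bullet> x \<le> 0}" if "a \<in> N - {0}" for a
  proof -
    have "a \<bullet> p < 0"
      using True normals(2) point(2) that by (force simp: order_less_le)
    with point(1) have "\<not> D \<subseteq> {x. a \<bullet> x \<ge> 0}"
      by (auto simp: not_le)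
    then show ?thesis
      using piece(2) that unfolding one_sided_def by blast
  qed
  then have "C \<inter> D = D"
    unfolding normals(2) by force
  with True show ?thesis by simp
next
  case False
  then obtain a where separating: "a \<in> N" "a \<bullet> p > 0"
    using normals(2) by (auto simp: not_le)
  then have "a \<noteq> 0" by auto
  have "D \<subseteq> {x. a \<bullet> x \<ge> 0}"
    using piece(2) separating point(1) \<open>a \<noteq> 0\<close> unfolding one_sided_def by force
  then have "C \<inter> D \<subseteq> {x. a \<bullet> x = 0}"
    using separating(1) normals(2) by force
  moreover have "polyhedral_cone C"
    using normals polyhedral_cone_iff by blast
  ultimately have "\<alpha> (C \<inter> D) = 0"
    using \<open>a \<noteq> 0\<close>
    by (intro cone_angle_subset_hyperplane[OF angle polyhedral_cone_Int[OF _ piece(1)]])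
  with False show ?thesis by simp
qed

lemma cone_angle_linear_relation_one_sided:
  fixes \<alpha> :: "'a::euclidean_space set \<Rightarrow> real" and w :: "'i \<Rightarrow> real"
  assumes angle: "cone_angle \<alpha>" and "finite I"
    and normals: "\<forall>i\<in>I. finite (N i) \<and> C i = {x. \<forall>a\<in>N i. a \<bullet> x \<le> 0}"
    and piece: "polyhedral_cone D" "\<forall>i\<in>I. \<forall>a\<in>N i - {0}. one_sided D a"
    and negl: "negligible {x. (\<Sum>i\<in>I. w i * indicator (C i) x) \<noteq> n}"
  shows "(\<Sum>i\<in>I. w i * \<alpha> (C i \<inter> D)) = n * \<alpha> D"
proof (cases "interior D = {}")
  case True
  have "\<alpha> (C i \<inter> D) = 0" if "i \<in> I" for i
  proof (rule cone_angle_empty_interior[OF angle polyhedral_cone_Int[OF _ piece(1)]])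
    show "polyhedral_cone (C i)"
      using normals that polyhedral_cone_iff by blast
  qed (simp add: True)
  moreover have "\<alpha> D = 0"
    using True by (rule cone_angle_empty_interior[OF angle piece(1)])
  ultimately show ?thesis by simp
next
  case False
  let ?A = "(\<Union>i\<in>I. N i) - {0}"
  let ?bad = "{x. (\<Sum>i\<in>I. w i * indicator (C i) x) \<noteq> n} \<union> (\<Union>a\<in>?A. {x. a \<bullet> x = 0})"
  have "finite ?A"
    using \<open>finite I\<close> normals by auto
  then have "negligible ?bad"
    using negl by (auto intro!: negligible_Un negligible_hyperplane)
  then have "\<not> interior D \<subseteq> ?bad"
    using open_not_negligible[OF open_interior False] negligible_subset by blast
  then obtain p where generic: "p \<in> D" "\<forall>a\<in>?A. a \<bullet> p \<noteq> 0" "(\<Sum>i\<in>I. w i * indicator (C i) p) = n"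
    using interior_subset by blast
  have "\<alpha> (C i \<inter> D) = indicator (C i) p * \<alpha> D" if "i \<in> I" for i
    using normals piece generic(1,2) that
    by (intro cone_angle_Int_one_sided[OF angle, of "N i"]) auto
  then have "(\<Sum>i\<in>I. w i * \<alpha> (C i \<inter> D)) = (\<Sum>i\<in>I. w i * indicator (C i) p) * \<alpha> D"
    by (simp add: sum_distrib_right mult.assoc)
  then show ?thesis
    unfolding generic(3) .
qed

lemma cone_angle_linear_relation:
  fixes \<alpha> :: "'a::euclidean_space set \<Rightarrow> real" and w :: "'i \<Rightarrow> real"
  assumes angle: "cone_angle \<alpha>" and "finite I" and cones: "\<And>i. i \<in> I \<Longrightarrow> polyhedral_cone (C i)"
    and negl: "negligible {x. (\<Sum>i\<in>I. w i * indicator (C i) x) \<noteq> n}"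
  shows "(\<Sum>i\<in>I. w i * \<alpha> (C i)) = n"
proof -
  have "\<forall>i\<in>I. \<exists>N. finite N \<and> C i = {x. \<forall>a\<in>N. a \<bullet> x \<le> 0}"
    using cones polyhedral_cone_iff by blast
  then obtain N where normals: "\<forall>i\<in>I. finite (N i) \<and> C i = {x. \<forall>a\<in>N i. a \<bullet> x \<le> 0}"
    by (rule bchoice[THEN exE])
  define A where "A = (\<Union>i\<in>I. N i) - {0}"
  have A_finite: "finite A" "0 \<notin> A"
    using \<open>finite I\<close> normals by (auto simp: A_def)
  define f where "f D = (\<Sum>i\<in>I. w i * \<alpha> (C i \<inter> D)) - n * \<alpha> D" for D
  have "f UNIV = 0"
  proof (rule cone_functional_eq_0_if_one_sided[OF A_finite _ _ polyhedral_cone_UNIV])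
    fix D :: "'a set" and a :: 'a
    assume piece: "polyhedral_cone D" and "a \<noteq> 0"
    have "\<alpha> (C i \<inter> D) = \<alpha> (C i \<inter> (D \<inter> {x. a \<bullet> x \<le> 0})) + \<alpha> (C i \<inter> (D \<inter> {x. a \<bullet> x \<ge> 0}))"
      if "i \<in> I" for i
      using cone_angle_split[OF angle polyhedral_cone_Int[OF cones[OF that] piece] \<open>a \<noteq> 0\<close>]
      by (simp only: Int_assoc)
    then show "f D = f (D \<inter> {x. a \<bullet> x \<le> 0}) + f (D \<inter> {x. a \<bullet> x \<ge> 0})"
      by (simp add: f_def cone_angle_split[OF angle piece \<open>a \<noteq> 0\<close>] distrib_left sum.distrib)
  next
    fix D :: "'a set"
    assume piece: "polyhedral_cone D" "\<forall>a\<in>A. one_sided D a"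
    then have "\<forall>i\<in>I. \<forall>a\<in>N i - {0}. one_sided D a"
      by (auto simp: A_def)
    from cone_angle_linear_relation_one_sided[OF angle \<open>finite I\<close> normals piece(1) this negl]
    show "f D = 0"
      by (simp add: f_def)
  qed
  then show ?thesis
    using angle by (simp add: f_def cone_angle_def)
qed

lemma cone_angle_tiling:
  fixes \<alpha> :: "'a::euclidean_space set \<Rightarrow> real"
  assumes angle: "cone_angle \<alpha>" and finite_I: "finite I"
    and cones: "\<And>i. i \<in> I \<Longrightarrow> polyhedral_cone (C i)"
    and negl: "negligible {x. \<not> (\<exists>!i. i \<in> I \<and> x \<in> C i)}"
  shows "(\<Sum>i\<in>I. \<alpha> (C i)) = 1"
proof -
  have "(\<Sum>i\<in>I. 1 * indicator (C i) x) = (1::real)"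
    if unique: "\<exists>!i. i \<in> I \<and> x \<in> C i" for x
  proof -
    obtain j where "j \<in> I" "\<And>i. i \<in> I \<Longrightarrow> x \<in> C i \<longleftrightarrow> i = j"
      using unique by metis
    with finite_I show ?thesis
      by (simp add: indicator_def sum.delta cong: sum.cong)
  qed
  then have "{x. (\<Sum>i\<in>I. 1 * indicator (C i) x) \<noteq> (1::real)} \<subseteq> {x. \<not> (\<exists>!i. i \<in> I \<and> x \<in> C i)}"
    by blast
  with negl have "negligible {x. (\<Sum>i\<in>I. 1 * indicator (C i) x) \<noteq> (1::real)}"
    by (rule negligible_subset)
  then show ?thesis
    using cone_angle_linear_relation[OF angle finite_I cones, where w = "\<lambda>_. 1" and n = 1] by simp
qed

section \<open>Euler characteristics of the cells of a central arrangement\<close>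

text \<open>On relatively open convex sets this is the Euler characteristic with compact supports.\<close>

definition euler_char :: "'a::euclidean_space set \<Rightarrow> real"
  where "euler_char S = (if S = {} then 0 else (-1) ^ nat (aff_dim S))"

lemma euler_char_empty [simp]: "euler_char {} = 0"
  by (simp add: euler_char_def)

lemma euler_char_subspace: "subspace V \<Longrightarrow> euler_char V = (-1) ^ dim V"
  using subspace_0 by (auto simp: euler_char_def aff_dim_subspace)

lemma euler_char_Int_open:
  fixes S :: "'a::euclidean_space set"
  assumes "convex S" "open T" "S \<inter> T \<noteq> {}"
  shows "euler_char (S \<inter> T) = euler_char S"
  using assms by (auto simp: euler_char_def aff_dim_convex_Int_open)

lemma rel_open_open: "open (S :: 'a::euclidean_space set) \<Longrightarrow> rel_open S"
  by (simp add: rel_open_def rel_interior_open)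

lemma rel_open_Int:
  fixes S T :: "'a::euclidean_space set"
  assumes "convex S" "rel_open S" "convex T" "rel_open T"
  shows "rel_open (S \<inter> T)"
  using convex_rel_open_finite_Inter[of "{S, T}"] assms by auto

lemma aff_dim_rel_open_Int_hyperplane:
  fixes S :: "'a::euclidean_space set"
  assumes "rel_open S" "S \<inter> {y. a \<bullet> y = 0} \<noteq> {}" "\<not> S \<subseteq> {y. a \<bullet> y = 0}"
  shows "aff_dim (S \<inter> {y. a \<bullet> y = 0}) = aff_dim S - 1"
proof -
  let ?H = "{y. a \<bullet> y = 0}" and ?A = "affine hull S"
  obtain T where S_eq: "open T" "S = ?A \<inter> T"
    using assms(1) by (auto simp: rel_open openin_open)
  then have Int_eq: "S \<inter> ?H = (?A \<inter> ?H) \<inter> T"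
    by blast
  have "aff_dim (S \<inter> ?H) = aff_dim (?A \<inter> ?H)"
    using assms(2) S_eq(1) unfolding Int_eq
    by (intro aff_dim_convex_Int_open convex_Int convex_affine_hull convex_hyperplane)
  also have "\<dots> = aff_dim S - 1"
    using assms(2,3) hull_subset[of S affine] by (auto simp: aff_dim_affine_Int_hyperplane)
  finally show ?thesis .
qed

lemma euler_char_Int_hyperplane:
  fixes S :: "'a::euclidean_space set"
  assumes "rel_open S" "S \<inter> {y. a \<bullet> y = 0} \<noteq> {}" "\<not> S \<subseteq> {y. a \<bullet> y = 0}"
  shows "euler_char (S \<inter> {y. a \<bullet> y = 0}) = - euler_char S"
proof -
  have "0 \<le> aff_dim (S \<inter> {y. a \<bullet> y = 0})"
    using assms(2) by (simp only: aff_dim_negative_iff not_False_eq_True flip: linorder_not_less)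
  then have "nat (aff_dim S) = Suc (nat (aff_dim (S \<inter> {y. a \<bullet> y = 0})))"
    using aff_dim_rel_open_Int_hyperplane[OF assms] by linarith
  then show ?thesis
    using assms(2) by (auto simp: euler_char_def)
qed

lemma rel_open_meets_both_sides:
  fixes S :: "'a::euclidean_space set"
  assumes rel_open_convex: "rel_open S" "convex S" and on_hyperplane: "x \<in> S" "a \<bullet> x = 0"
    and off_hyperplane: "y \<in> S" "a \<bullet> y \<noteq> 0"
  shows "S \<inter> {y. a \<bullet> y < 0} \<noteq> {}" "S \<inter> {y. a \<bullet> y > 0} \<noteq> {}"
proof -
  obtain e where beyond: "e > 1" "(1 - e) *\<^sub>R y + e *\<^sub>R x \<in> S"
    using convex_rel_interior_iff[of S x] assms by (auto simp: rel_open_def)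
  have "a \<bullet> ((1 - e) *\<^sub>R y + e *\<^sub>R x) = (1 - e) * (a \<bullet> y)"
    using on_hyperplane(2) by (simp add: inner_add_right)
  moreover have "(1 - e) * (a \<bullet> y) < 0 \<longleftrightarrow> a \<bullet> y > 0" "(1 - e) * (a \<bullet> y) > 0 \<longleftrightarrow> a \<bullet> y < 0"
    using beyond(1) by (auto simp: mult_less_0_iff zero_less_mult_iff)
  ultimately show "S \<inter> {y. a \<bullet> y < 0} \<noteq> {}" "S \<inter> {y. a \<bullet> y > 0} \<noteq> {}"
    using beyond(2) off_hyperplane by (cases "a \<bullet> y > 0"; force)+
qed

lemma convex_misses_hyperplane:
  fixes S :: "'a::real_inner set"
  assumes "convex S" "S \<inter> {y. a \<bullet> y = 0} = {}"
  shows "S \<subseteq> {y. a \<bullet> y < 0} \<or> S \<subseteq> {y. a \<bullet> y > 0}"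
proof (rule ccontr)
  assume "\<not> ?thesis"
  then obtain u v where "u \<in> S" "v \<in> S" "a \<bullet> v \<le> 0" "a \<bullet> u \<ge> 0"
    unfolding subset_iff mem_Collect_eq not_less de_Morgan_disj not_all not_imp by blast
  then have "\<exists>z\<in>S. a \<bullet> z = 0"
    using connected_ivt_hyperplane[OF convex_connected[OF assms(1)], of v u a 0] by blast
  with assms(2) show False by blast
qed

lemma euler_char_split:
  fixes S :: "'a::euclidean_space set"
  assumes rel_open_convex: "rel_open S" "convex S"
  shows "euler_char S = euler_char (S \<inter> {y. a \<bullet> y < 0}) + euler_char (S \<inter> {y. a \<bullet> y = 0})
    + euler_char (S \<inter> {y. a \<bullet> y > 0})"
    (is "_ = euler_char ?L + euler_char ?M + euler_char ?R")
proof -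
  consider (negative) "S \<subseteq> {y. a \<bullet> y < 0}" | (positive) "S \<subseteq> {y. a \<bullet> y > 0}"
    | (inside) "S \<subseteq> {y. a \<bullet> y = 0}" | (crossing) x y where "x \<in> ?M" "y \<in> S" "a \<bullet> y \<noteq> 0"
    using convex_misses_hyperplane[OF rel_open_convex(2), of a] by blast
  then show ?thesis
  proof cases
    case negative
    then have "?L = S" "?M = {}" "?R = {}"
      by force+
    then show ?thesis by simp
  next
    case positive
    then have "?L = {}" "?M = {}" "?R = S"
      by force+
    then show ?thesis by simp
  next
    case inside
    then have "?L = {}" "?M = S" "?R = {}"
      by force+
    then show ?thesis by simp
  next
    case crossing
    then have "?L \<noteq> {}" "?R \<noteq> {}"
      using rel_open_meets_both_sides[OF rel_open_convex] by blast+
    then have "euler_char ?L = euler_char S" "euler_char ?R = euler_char S"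
      using rel_open_convex(2)
      by (auto intro!: euler_char_Int_open open_halfspace_lt open_halfspace_gt)
    moreover have "euler_char ?M = - euler_char S"
      using crossing by (intro euler_char_Int_hyperplane[OF rel_open_convex(1)]) auto
    ultimately show ?thesis by simp
  qed
qed

lemma sum_euler_char_sgn:
  fixes S :: "'a::euclidean_space set"
  assumes "rel_open S" "convex S"
  shows "(\<Sum>v\<in>{-1, 0, 1}. euler_char (S \<inter> {y. sgn (a \<bullet> y) = v})) = euler_char S"
  using euler_char_split[OF assms, of a] by (simp add: sgn_1_pos sgn_1_neg sgn_eq_0_iff)

lemma orthogonal_comp_span: "(span B)\<^sup>\<bottom> = B\<^sup>\<bottom>"
  for B :: "'a::euclidean_space set"
proof
  have "span B \<subseteq> {x. orthogonal x c}" if "c \<in> B\<^sup>\<bottom>" for c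
    using that by (intro span_minimal)
      (auto simp: orthogonal_comp_def orthogonal_def subspace_def inner_add_left)
  then show "B\<^sup>\<bottom> \<subseteq> (span B)\<^sup>\<bottom>"
    by (auto simp: orthogonal_comp_def)
qed (rule orthogonal_comp_anti_mono[OF span_superset])

lemma orthogonal_comp_orthogonal_comp: "B\<^sup>\<bottom>\<^sup>\<bottom> = span B"
  for B :: "'a::euclidean_space set"
  by (metis orthogonal_comp_self orthogonal_comp_span subspace_span)

lemma dim_orthogonal_comp: "dim (B\<^sup>\<bottom>) = DIM('a) - dim B"
  for B :: "'a::euclidean_space set"
proof -
  have "dim ((span B)\<^sup>\<bottom>) + dim (span B) = DIM('a)"
    using dim_subspace_orthogonal_to_vectors[OF subspace_span subspace_UNIV subset_UNIV, of B]
    by (simp add: orthogonal_comp_def)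
  then show ?thesis
    by (simp add: orthogonal_comp_span)
qed

definition cell :: "'a::real_inner set \<Rightarrow> 'a \<Rightarrow> 'a set"
  where "cell G c = {c'. \<forall>g\<in>G. sgn (g \<bullet> c') = sgn (g \<bullet> c)}"

lemma cell_empty [simp]: "cell {} = (\<lambda>_. UNIV)"
  by (auto simp: cell_def)

lemma cell_eq_iff: "cell G c = cell G c' \<longleftrightarrow> c' \<in> cell G c"
  by (auto simp: cell_def)

lemma cell_eq_orthogonal_comp_Int_open:
  fixes G :: "'a::euclidean_space set"
  assumes "finite G"
  obtains T where "open T" "convex T" "cell G c = {g \<in> G. g \<bullet> c = 0}\<^sup>\<bottom> \<inter> T"
proof
  let ?N = "{g \<in> G. g \<bullet> c \<noteq> 0}"
  let ?T = "\<Inter>g\<in>?N. {c'. 0 < (sgn (g \<bullet> c) *\<^sub>R g) \<bullet> c'}"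
  have "finite ?N"
    using assms by simp
  then show "open ?T"
    by (intro open_INT ballI open_halfspace_gt)
  show "convex ?T"
    by (intro convex_INT convex_halfspace_gt)
  have "sgn r = sgn s \<longleftrightarrow> (s = 0 \<longrightarrow> r = 0) \<and> (s \<noteq> 0 \<longrightarrow> 0 < sgn s * r)" for r s :: real
    by (auto simp: sgn_real_def)
  then show "cell G c = {g \<in> G. g \<bullet> c = 0}\<^sup>\<bottom> \<inter> ?T"
    by (auto simp: cell_def orthogonal_comp_def orthogonal_def)
qed

lemma
  fixes G :: "'a::euclidean_space set"
  assumes "finite G"
  shows convex_cell: "convex (cell G c)"
    and rel_open_cell: "rel_open (cell G c)"
    and euler_char_cell: "euler_char (cell G c) = (-1) ^ (DIM('a) - dim {g \<in> G. g \<bullet> c = 0})"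
    and orthogonal_comp_cell: "(cell G c)\<^sup>\<bottom> = span {g \<in> G. g \<bullet> c = 0}"
proof -
  let ?B = "{g \<in> G. g \<bullet> c = 0}"
  obtain T where T: "open T" "convex T" and cell: "cell G c = ?B\<^sup>\<bottom> \<inter> T"
    using cell_eq_orthogonal_comp_Int_open[OF assms] by blast
  have sub: "subspace (?B\<^sup>\<bottom>)"
    by (rule subspace_orthogonal_comp)
  then have conv: "convex (?B\<^sup>\<bottom>)" and aff: "affine (?B\<^sup>\<bottom>)"
    by (auto intro: subspace_imp_convex subspace_imp_affine)
  have ne: "?B\<^sup>\<bottom> \<inter> T \<noteq> {}"
    unfolding cell[symmetric] by (auto simp: cell_def)
  show "convex (cell G c)"
    unfolding cell using conv T by (intro convex_Int)
  show "rel_open (cell G c)"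
    unfolding cell using conv aff T by (intro rel_open_Int affine_rel_open rel_open_open)
  show "euler_char (cell G c) = (-1) ^ (DIM('a) - dim ?B)"
    unfolding cell euler_char_Int_open[OF conv T(1) ne]
    by (simp only: euler_char_subspace[OF sub] dim_orthogonal_comp)
  have "span (cell G c) = ?B\<^sup>\<bottom>"
  proof
    show "span (cell G c) \<subseteq> ?B\<^sup>\<bottom>"
      unfolding cell by (intro span_minimal[OF _ sub]) blast
    have "?B\<^sup>\<bottom> = affine hull (cell G c)"
      unfolding cell using affine_hull_affine_Int_open[OF aff T(1) ne] hull_same[of affine, OF aff]
      by simp
    then show "?B\<^sup>\<bottom> \<subseteq> span (cell G c)"
      using affine_hull_subset_span by blast
  qed
  then show "(cell G c)\<^sup>\<bottom> = span ?B"
    by (metis orthogonal_comp_orthogonal_comp orthogonal_comp_span)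
qed

lemma mem_cell_Int_sgnD:
  "y \<in> cell G c \<inter> {y. sgn (a \<bullet> y) = v} \<Longrightarrow> cell G c = cell G y \<and> v = sgn (a \<bullet> y)"
  by (auto simp: cell_eq_iff)

lemma range_cell_insert:
  "range (cell (insert a G))
    = (\<lambda>(\<tau>, v). \<tau> \<inter> {y. sgn (a \<bullet> y) = v}) ` (range (cell G) \<times> {-1, 0, 1}) - {{}}"
proof -
  have cell_insert: "cell (insert a G) c = cell G c \<inter> {y. sgn (a \<bullet> y) = sgn (a \<bullet> c)}" for c
    by (auto simp: cell_def)
  have sgn_cases: "sgn r \<in> {-1, 0, 1}" for r :: real
    by (simp add: sgn_real_def)
  show ?thesis
  proof (intro subset_antisym subsetI)
    fix \<tau> assume "\<tau> \<in> range (cell (insert a G))"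
    then obtain c where "\<tau> = cell (insert a G) c" by blast
    then show "\<tau> \<in> (\<lambda>(\<tau>, v). \<tau> \<inter> {y. sgn (a \<bullet> y) = v}) ` (range (cell G) \<times> {-1, 0, 1}) - {{}}"
      using sgn_cases[of "a \<bullet> c"] cell_insert[of c]
      by (auto simp: cell_def intro!: image_eqI[of _ _ "(cell G c, sgn (a \<bullet> c))"])
  next
    fix \<tau> assume "\<tau> \<in> (\<lambda>(\<tau>, v). \<tau> \<inter> {y. sgn (a \<bullet> y) = v}) ` (range (cell G) \<times> {-1, 0, 1}) - {{}}"
    then obtain c v where \<tau>: "\<tau> = cell G c \<inter> {y. sgn (a \<bullet> y) = v}" and "\<tau> \<noteq> {}"
      by auto
    then obtain y where "y \<in> \<tau>"
      by blast
    then have "cell G c = cell G y \<and> v = sgn (a \<bullet> y)"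
      unfolding \<tau> by (rule mem_cell_Int_sgnD)
    then have "\<tau> = cell (insert a G) y"
      by (simp add: \<tau> cell_insert)
    then show "\<tau> \<in> range (cell (insert a G))" by blast
  qed
qed

lemma finite_range_cell: "finite G \<Longrightarrow> finite (range (cell G))"
  by (induction G rule: finite_induct) (simp_all add: range_cell_insert)

lemma sum_euler_char_cells:
  fixes S :: "'a::euclidean_space set"
  assumes "finite G" "rel_open S" "convex S"
  shows "(\<Sum>\<tau>\<in>range (cell G). euler_char (S \<inter> \<tau>)) = euler_char S"
  using assms(1)
proof (induction G rule: finite_induct)
  case empty
  show ?case by simp
next
  case (insert a G)
  define h where "h = (\<lambda>(\<tau>, v). \<tau> \<inter> {y. sgn (a \<bullet> y) = v})"
  let ?X = "range (cell G) \<times> {-1, 0, 1}"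
  have finite_X: "finite ?X"
    using finite_range_cell[OF insert.hyps(1)] by simp
  have split: "(\<Sum>v\<in>{-1, 0, 1}. euler_char (S \<inter> h (\<tau>, v))) = euler_char (S \<inter> \<tau>)"
    if "\<tau> \<in> range (cell G)" for \<tau>
  proof -
    obtain c where \<tau>: "\<tau> = cell G c"
      using \<open>\<tau> \<in> range (cell G)\<close> by blast
    have "rel_open (S \<inter> \<tau>)" "convex (S \<inter> \<tau>)"
      unfolding \<tau> using assms(2,3) convex_cell[OF insert.hyps(1)] rel_open_cell[OF insert.hyps(1)]
      by (simp_all add: rel_open_Int convex_Int)
    from sum_euler_char_sgn[OF this, of a] show ?thesis
      by (simp add: h_def Int_assoc)
  qed
  have overlap: "h p = {}" if images_eq: "p \<in> ?X" "q \<in> ?X" "p \<noteq> q" "h p = h q" for p q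
  proof (rule ccontr)
    assume "h p \<noteq> {}"
    then obtain y where "y \<in> h p" "y \<in> h q"
      using images_eq(4) by blast
    then have "p = (cell G y, sgn (a \<bullet> y))" "q = (cell G y, sgn (a \<bullet> y))"
      using images_eq(1,2) mem_cell_Int_sgnD[of y G _ a] by (force simp: h_def)+
    with images_eq(3) show False by simp
  qed
  have "(\<Sum>\<tau>\<in>range (cell (insert a G)). euler_char (S \<inter> \<tau>)) = (\<Sum>\<tau>\<in>h ` ?X. euler_char (S \<inter> \<tau>))"
    unfolding range_cell_insert h_def[symmetric] using finite_X
    by (intro sum.mono_neutral_left) auto
  also have "\<dots> = (\<Sum>p\<in>?X. euler_char (S \<inter> h p))"
    by (rule sum.reindex_nontrivial[OF finite_X, unfolded o_def])
      (metis overlap Int_empty_right euler_char_empty)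
  also have "\<dots> = (\<Sum>\<tau>\<in>range (cell G). \<Sum>v\<in>{-1, 0, 1}. euler_char (S \<inter> h (\<tau>, v)))"
    by (simp only: sum.cartesian_product case_prod_unfold prod.collapse)
  also have "\<dots> = euler_char S"
    using split insert.IH by simp
  finally show ?case .
qed

section \<open>Faces, tangent cones and normal cones of polytopes\<close>

lemma diff_mem_lin_space: "x \<in> F \<Longrightarrow> y \<in> F \<Longrightarrow> x - y \<in> lin_space F"
  using hull_inc[of x F affine] hull_inc[of y F affine] by (auto simp: lin_space_def)

lemma lin_space_subset:
  assumes "subspace V" and diff: "\<And>x y. \<lbrakk>x \<in> F; y \<in> F\<rbrakk> \<Longrightarrow> x - y \<in> V"
  shows "lin_space F \<subseteq> V"
proof (cases "F = {}")
  case True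
  then show ?thesis by (simp add: lin_space_def)
next
  case False
  then obtain q where "q \<in> F" by blast
  have "affine ((+) q ` V)"
    using assms(1) by (simp add: affine_translation[symmetric] subspace_imp_affine)
  moreover have "F \<subseteq> (+) q ` V"
    using diff[OF _ \<open>q \<in> F\<close>] by (force simp: image_iff algebra_simps)
  ultimately have "affine hull F \<subseteq> (+) q ` V"
    by (rule hull_minimal[rotated])
  then have in_V: "x - q \<in> V" if "x \<in> affine hull F" for x
    using that by auto
  have "x - y \<in> V" if "x \<in> affine hull F" "y \<in> affine hull F" for x y
    using subspace_diff[OF assms(1) in_V[OF that(1)] in_V[OF that(2)]] by simp
  then show ?thesis
    by (auto simp: lin_space_def)
qed

lemma aff_dim_eq_dim_lin_space:
  fixes F :: "'a::euclidean_space set"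
  assumes "F \<noteq> {}"
  shows "aff_dim F = int (dim (lin_space F))"
proof -
  have subspace: "subspace (lin_space F)"
    by (rule lin_space_parallel(1)[OF assms])
  then have "affine hull (lin_space F) = lin_space F"
    by (simp add: hull_same subspace_imp_affine)
  then have "aff_dim F = aff_dim (lin_space F)"
    using lin_space_parallel(2)[OF assms] by (intro aff_dim_parallel_eq) (simp only:)
  then show ?thesis
    by (simp add: aff_dim_subspace[OF subspace])
qed

definition max_face :: "'a::real_inner set \<Rightarrow> 'a \<Rightarrow> 'a set"
  where "max_face P c = {x \<in> P. \<forall>y\<in>P. c \<bullet> y \<le> c \<bullet> x}"

lemma max_face_subset: "max_face P c \<subseteq> P"
  by (auto simp: max_face_def)

lemma max_face_singleton [simp]: "max_face {x} c = {x}"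
  by (auto simp: max_face_def)

lemma max_face_nonempty: "compact P \<Longrightarrow> P \<noteq> {} \<Longrightarrow> max_face P c \<noteq> {}"
  using continuous_attains_sup[of P "\<lambda>x. c \<bullet> x"]
  by (fastforce simp: max_face_def intro: continuous_intros)

lemma max_face_scaleR: "t > 0 \<Longrightarrow> max_face P (t *\<^sub>R c) = max_face P c"
  by (simp add: max_face_def)

lemma max_face_add:
  assumes "max_face P c \<inter> max_face P c' \<noteq> {}"
  shows "max_face P (c + c') = max_face P c \<inter> max_face P c'"
proof
  show "max_face P c \<inter> max_face P c' \<subseteq> max_face P (c + c')"
    by (auto simp: max_face_def inner_add_left add_mono)
  obtain z where common: "z \<in> max_face P c" "z \<in> max_face P c'"
    using assms by blast
  have "c \<bullet> x = c \<bullet> z \<and> c' \<bullet> x = c' \<bullet> z" if "x \<in> max_face P (c + c')" for x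
  proof -
    have "c \<bullet> x \<le> c \<bullet> z" "c' \<bullet> x \<le> c' \<bullet> z" "c \<bullet> z + c' \<bullet> z \<le> c \<bullet> x + c' \<bullet> x"
      using that common by (auto simp: max_face_def inner_add_left)
    then show ?thesis by linarith
  qed
  then show "max_face P (c + c') \<subseteq> max_face P c \<inter> max_face P c'"
    using common by (auto simp: max_face_def)
qed

lemma max_face_face_of:
  assumes "convex P"
  shows "max_face P c face_of P"
proof (cases "max_face P c = {}")
  case False
  then obtain q where maximizer: "q \<in> max_face P c" by blast
  then have "max_face P c = P \<inter> {x. c \<bullet> x = c \<bullet> q}"
    by (auto simp: max_face_def intro: antisym)
  moreover have "P \<inter> {x. c \<bullet> x = c \<bullet> q} face_of P"
    using maximizer
    by (intro face_of_Int_supporting_hyperplane_le[OF assms]) (auto simp: max_face_def)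
  ultimately show ?thesis by simp
qed simp

lemma nonempty_faces_eq_range_max_face:
  fixes P :: "'a::euclidean_space set"
  assumes "polytope P" "P \<noteq> {}"
  shows "{F. F face_of P \<and> F \<noteq> {}} = range (max_face P)"
proof (intro subset_antisym subsetI)
  fix F assume face: "F \<in> {F. F face_of P \<and> F \<noteq> {}}"
  then have "F exposed_face_of P"
    using assms(1) by (simp add: exposed_face_of_polyhedron polytope_imp_polyhedron)
  then obtain c b where "P \<subseteq> {x. c \<bullet> x \<le> b}" "F = P \<inter> {x. c \<bullet> x = b}"
    unfolding exposed_face_of_def by blast
  with face have "F = max_face P c"
    by (force simp: max_face_def)
  then show "F \<in> range (max_face P)" by blast
next
  fix F assume "F \<in> range (max_face P)"
  then show "F \<in> {F. F face_of P \<and> F \<noteq> {}}"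
    using max_face_face_of[OF polytope_imp_convex[OF assms(1)]]
      max_face_nonempty[OF polytope_imp_compact[OF assms(1)] assms(2)] by auto
qed

definition parallel_faces :: "'a::euclidean_space set \<Rightarrow> 'a set \<Rightarrow> 'a set set"
  where "parallel_faces P U = {F. F face_of P \<and> F \<noteq> {} \<and> lin_space F = U}"

lemma parallel_faces_incomparable:
  assumes F_parallel: "F \<in> parallel_faces P U" and F'_parallel: "F' \<in> parallel_faces P U"
    and "F \<subseteq> F'"
  shows "F = F'"
proof (rule ccontr)
  assume "F \<noteq> F'"
  have faces: "F face_of P" "F' face_of P"
    using F_parallel F'_parallel by (auto simp: parallel_faces_def)
  then have "F face_of F'"
    by (intro face_of_subset[OF _ \<open>F \<subseteq> F'\<close>] face_of_imp_subset)
  moreover have "convex F'"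
    using faces(2) by (rule face_of_imp_convex)
  ultimately have "aff_dim F < aff_dim F'"
    using \<open>F \<noteq> F'\<close> by (intro face_of_aff_dim_lt)
  then show False
    using F_parallel F'_parallel by (auto simp: parallel_faces_def aff_dim_eq_dim_lin_space)
qed

lemma sum_faces_by_flats:
  fixes P :: "'a::euclidean_space set"
  assumes "polytope P"
  shows "(\<Sum>F | F face_of P \<and> F \<noteq> {} \<and> Q (lin_space F). f F)
    = (\<Sum>U | U \<in> flats P \<and> Q U. \<Sum>F\<in>parallel_faces P U. f F)"
proof -
  let ?faces = "{F. F face_of P \<and> F \<noteq> {} \<and> Q (lin_space F)}"
  have finite_faces: "finite ?faces"
    using finite_polytope_faces[OF assms] by (rule rev_finite_subset) blast
  have flats_eq: "{U. U \<in> flats P \<and> Q U} = lin_space ` ?faces"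
    by (auto simp: flats_def)
  have "(\<Sum>F\<in>?faces. f F) = (\<Sum>U\<in>lin_space ` ?faces. \<Sum>F\<in>{F \<in> ?faces. lin_space F = U}. f F)"
    by (rule sum.image_gen[OF finite_faces])
  also have "\<dots> = (\<Sum>U\<in>lin_space ` ?faces. \<Sum>F\<in>parallel_faces P U. f F)"
    by (intro sum.cong) (auto simp: parallel_faces_def)
  finally show ?thesis
    unfolding flats_eq .
qed

lemma sum_faces_of_dim_by_flats:
  fixes P :: "'a::euclidean_space set"
  assumes "polytope P"
  shows "(\<Sum>F | F face_of P \<and> aff_dim F = int i. f F)
    = (\<Sum>U | U \<in> flats P \<and> dim U = i. \<Sum>F\<in>parallel_faces P U. f F)"
proof -
  have "F face_of P \<and> aff_dim F = int i \<longleftrightarrow> F face_of P \<and> F \<noteq> {} \<and> dim (lin_space F) = i" for F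
    using aff_dim_eq_dim_lin_space[of F] by (cases "F = {}") auto
  then show ?thesis
    using sum_faces_by_flats[OF assms, where Q = "\<lambda>U. dim U = i"] by simp
qed

lemma finite_flats:
  fixes P :: "'a::euclidean_space set"
  assumes "polytope P"
  shows "finite (flats P)"
proof -
  have "flats P \<subseteq> lin_space ` {F. F face_of P}"
    by (auto simp: flats_def)
  then show ?thesis
    using finite_polytope_faces[OF assms] finite_surj by blast
qed

lemma subspace_flat: "U \<in> flats P \<Longrightarrow> subspace U"
  using lin_space_parallel(1) by (auto simp: flats_def)

lemma polyhedral_cone_tangent_cone:
  fixes P :: "'a::euclidean_space set"
  assumes "polytope P"
  shows "polyhedral_cone (tangent_cone F P)"
proof -
  have "polytope ((\<lambda>x. - q + x) ` P)" for q
    using assms by (simp only: polytope_translation_eq)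
  then show ?thesis
    unfolding tangent_cone_def Let_def polyhedral_cone_def
    using convex_cone_convex_cone_hull polyhedron_convex_cone_hull_polytope by blast
qed

lemma normal_cone_iff_tangent_cone:
  fixes P :: "'a::euclidean_space set"
  assumes convex_subset: "F \<subseteq> P" "convex F" "F \<noteq> {}"
  shows "c \<in> normal_cone F P \<longleftrightarrow> (\<forall>x\<in>tangent_cone F P. c \<bullet> x \<le> 0)"
proof -
  obtain q where rel_interior_q: "q \<in> rel_interior F"
    using rel_interior_eq_empty[OF convex_subset(2)] convex_subset(3) by blast
  then have "q \<in> F"
    using rel_interior_subset by blast
  have tangent_cone: "tangent_cone F P = convex_cone hull ((\<lambda>x. - q + x) ` P)"
    by (rule tangent_cone_eq[OF convex_subset(1,2) rel_interior_q])
  show ?thesis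
  proof
    assume normal: "c \<in> normal_cone F P"
    have "tangent_cone F P \<subseteq> {x. c \<bullet> x \<le> 0}"
      unfolding tangent_cone
    proof (rule hull_minimal)
      show "(\<lambda>x. - q + x) ` P \<subseteq> {x. c \<bullet> x \<le> 0}"
        using normal \<open>q \<in> F\<close> by (auto simp: normal_cone_def inner_diff_right)
    qed (rule convex_cone_halfspace_le)
    then show "\<forall>x\<in>tangent_cone F P. c \<bullet> x \<le> 0" by blast
  next
    assume nonpos: "\<forall>x\<in>tangent_cone F P. c \<bullet> x \<le> 0"
    have "- x + y \<in> tangent_cone F P" if "x \<in> F" "y \<in> P" for x y
      using convex_cone_hull_translate_le[OF convex_subset(1,2) rel_interior_q that(1)] that(2)
      unfolding tangent_cone
      by (auto intro: hull_inc)
    then show "c \<in> normal_cone F P"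
      using nonpos by (fastforce simp: normal_cone_def inner_diff_right)
  qed
qed

lemma tangent_cone_iff_normal_cone:
  fixes P :: "'a::euclidean_space set"
  assumes polytope: "polytope P" and face: "F face_of P" "F \<noteq> {}"
  shows "x \<in> tangent_cone F P \<longleftrightarrow> (\<forall>c\<in>normal_cone F P. c \<bullet> x \<le> 0)"
proof -
  have normal_iff: "c \<in> normal_cone F P \<longleftrightarrow> (\<forall>y\<in>tangent_cone F P. c \<bullet> y \<le> 0)" for c
    using face by (intro normal_cone_iff_tangent_cone face_of_imp_subset face_of_imp_convex)
  obtain N where tangent_eq: "tangent_cone F P = {x. \<forall>a\<in>N. a \<bullet> x \<le> 0}"
    using polyhedral_cone_tangent_cone[OF polytope] polyhedral_cone_iff by blast
  then have "N \<subseteq> normal_cone F P"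
    by (auto simp: normal_iff)
  then show ?thesis
    using tangent_eq normal_iff by blast
qed

lemma tangent_cone_eq_rays:
  fixes F P :: "'a::euclidean_space set"
  assumes "convex P" "F \<subseteq> P" "convex F" and rel_interior_q: "q \<in> rel_interior F"
  shows "tangent_cone F P = {t *\<^sub>R (y - q) | t y. 0 \<le> t \<and> y \<in> P}"
proof -
  have "convex ((\<lambda>x. - q + x) ` P)" "P \<noteq> {}"
    using assms rel_interior_subset by auto
  then have "tangent_cone F P = (\<Union>x\<in>(\<lambda>x. - q + x) ` P. \<Union>t\<in>{0..}. {t *\<^sub>R x})"
    by (simp add: tangent_cone_eq[OF assms(2,3) rel_interior_q]
        convex_cone_hull_convex_hull_nonempty hull_same)
  then show ?thesis
    by auto
qed

lemma in_open_segment_if_opposite_directions: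
  fixes q :: "'a::real_vector"
  assumes positive: "0 < t" "0 < s" and opposite: "t *\<^sub>R (y - q) + s *\<^sub>R (z - q) = 0" and "y \<noteq> q"
  shows "q \<in> open_segment y z"
proof -
  define u where "u = s / (t + s)"
  have u_bounds: "0 < u" "u < 1" "(t + s) * (1 - u) = t" "(t + s) * u = s"
    using positive by (auto simp: u_def field_simps)
  have "(t + s) *\<^sub>R ((1 - u) *\<^sub>R y + u *\<^sub>R z) = t *\<^sub>R y + s *\<^sub>R z"
    using u_bounds(3,4) by (simp add: scaleR_add_right)
  also have "\<dots> = (t + s) *\<^sub>R q"
    using opposite by (simp add: algebra_simps)
  finally have "q = (1 - u) *\<^sub>R y + u *\<^sub>R z"
    using positive by simp
  moreover have "y \<noteq> z"
  proof
    assume "y = z"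
    then have "(t + s) *\<^sub>R (y - q) = 0"
      using opposite by (simp add: scaleR_add_left)
    with positive \<open>y \<noteq> q\<close> show False by simp
  qed
  ultimately show ?thesis
    using u_bounds(1,2) in_segment(2) by blast
qed

lemma tangent_cone_lineality:
  fixes P :: "'a::euclidean_space set"
  assumes "convex P" and face: "F face_of P" "F \<noteq> {}"
    and both_directions: "x \<in> tangent_cone F P" "- x \<in> tangent_cone F P"
  shows "x \<in> lin_space F"
proof (cases "x = 0")
  case True
  then show ?thesis
    by (simp add: subspace_0 lin_space_parallel(1)[OF face(2)])
next
  case False
  have convex_subset: "F \<subseteq> P" "convex F"
    using face(1) face_of_imp_subset face_of_imp_convex by blast+
  obtain q where rel_interior_q: "q \<in> rel_interior F"
    using rel_interior_eq_empty[OF convex_subset(2)] face(2) by blast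
  then have "q \<in> F"
    using rel_interior_subset by blast
  obtain t y s z where ray: "0 \<le> t" "y \<in> P" "x = t *\<^sub>R (y - q)"
    and opposite_ray: "0 \<le> s" "z \<in> P" "- x = s *\<^sub>R (z - q)"
    using both_directions unfolding tangent_cone_eq_rays[OF assms(1) convex_subset rel_interior_q]
    by blast
  have positive: "0 < t" "0 < s" and "y \<noteq> q"
    using False ray opposite_ray by (auto simp: order_less_le)
  have "t *\<^sub>R (y - q) + s *\<^sub>R (z - q) = 0"
    by (simp flip: ray(3) opposite_ray(3))
  then have "q \<in> open_segment y z"
    by (rule in_open_segment_if_opposite_directions[OF positive _ \<open>y \<noteq> q\<close>])
  then have "y \<in> F"
    using face_ofD[OF face(1) _ ray(2) opposite_ray(2) \<open>q \<in> F\<close>] by blast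
  then show ?thesis
    unfolding ray(3) using \<open>q \<in> F\<close>
    by (intro subspace_scale lin_space_parallel(1)[OF face(2)] diff_mem_lin_space)
qed

lemma normal_cone_eq_max_face: "F \<subseteq> P \<Longrightarrow> normal_cone F P = {c. F \<subseteq> max_face P c}"
  by (auto simp: normal_cone_def max_face_def)

lemma normal_cone_subset_orthogonal_comp:
  assumes "F \<subseteq> P"
  shows "normal_cone F P \<subseteq> (lin_space F)\<^sup>\<bottom>"
proof
  fix c assume "c \<in> normal_cone F P"
  then have "c \<bullet> y \<le> c \<bullet> x" if "x \<in> F" "y \<in> F" for x y
    using assms that by (auto simp: normal_cone_def)
  then have "c \<bullet> (x - y) = 0" if "x \<in> F" "y \<in> F" for x y
    using that by (simp add: inner_diff_right antisym)
  then have "lin_space F \<subseteq> {x. c \<bullet> x = 0}"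
    by (intro lin_space_subset subspace_hyperplane) simp
  then show "c \<in> (lin_space F)\<^sup>\<bottom>"
    by (auto simp: orthogonal_comp_def orthogonal_def inner_commute)
qed

lemma polyhedral_cone_normal_cone:
  fixes F P :: "'a::euclidean_space set"
  assumes "polytope F" "polytope P"
  shows "polyhedral_cone (normal_cone F P)"
proof -
  obtain A B where F_eq: "finite A" "F = convex hull A" and P_eq: "finite B" "P = convex hull B"
    using assms by (auto simp: polytope_def)
  have "c \<in> normal_cone F P \<longleftrightarrow> (\<forall>a\<in>A. \<forall>b\<in>B. c \<bullet> (b - a) \<le> 0)" for c
  proof
    assume "c \<in> normal_cone F P"
    then show "\<forall>a\<in>A. \<forall>b\<in>B. c \<bullet> (b - a) \<le> 0"
      using hull_inc[of _ A convex] hull_inc[of _ B convex]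
      by (auto simp: normal_cone_def F_eq(2) P_eq(2) inner_diff_right)
  next
    assume vertices_le: "\<forall>a\<in>A. \<forall>b\<in>B. c \<bullet> (b - a) \<le> 0"
    have "P \<subseteq> {y. c \<bullet> y \<le> c \<bullet> a}" if "a \<in> A" for a
      unfolding P_eq(2) using vertices_le that
      by (intro hull_minimal convex_halfspace_le) (auto simp: inner_diff_right)
    then have "F \<subseteq> {x. c \<bullet> x \<ge> c \<bullet> y}" if "y \<in> P" for y
      unfolding F_eq(2) using that by (intro hull_minimal convex_halfspace_ge) auto
    then show "c \<in> normal_cone F P"
      by (auto simp: normal_cone_def)
  qed
  then have "normal_cone F P = {c. \<forall>v\<in>(\<lambda>(a, b). b - a) ` (A \<times> B). v \<bullet> c \<le> 0}"
    by (auto simp: inner_commute)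
  moreover have "finite ((\<lambda>(a, b). b - a) ` (A \<times> B))"
    using F_eq(1) P_eq(1) by simp
  ultimately show ?thesis
    using polyhedral_cone_iff by blast
qed

definition open_normal_cone :: "'a::euclidean_space set \<Rightarrow> 'a set \<Rightarrow> 'a set"
  where "open_normal_cone F P = {c. max_face P c = F}"

lemma open_normal_cone_subset: "F \<subseteq> P \<Longrightarrow> open_normal_cone F P \<subseteq> normal_cone F P"
  by (auto simp: open_normal_cone_def normal_cone_eq_max_face)

lemma tangent_cone_iff_open_normal_cone:
  fixes P :: "'a::euclidean_space set"
  assumes polytope: "polytope P" and face: "F face_of P" "F \<noteq> {}"
  shows "x \<in> tangent_cone F P \<longleftrightarrow> (\<forall>c\<in>open_normal_cone F P. c \<bullet> x \<le> 0)"
proof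
  have subset: "F \<subseteq> P"
    using face(1) by (rule face_of_imp_subset)
  then show "\<forall>c\<in>open_normal_cone F P. c \<bullet> x \<le> 0" if "x \<in> tangent_cone F P"
    using that open_normal_cone_subset[OF subset] tangent_cone_iff_normal_cone[OF polytope face]
    by blast
  assume open_le: "\<forall>c\<in>open_normal_cone F P. c \<bullet> x \<le> 0"
  obtain c where F_eq: "F = max_face P c"
    using nonempty_faces_eq_range_max_face[OF polytope] face subset by blast
  have "c' \<bullet> x \<le> 0" if "c' \<in> normal_cone F P" for c'
  proof -
    have perturbed: "c' \<bullet> x + t * (c \<bullet> x) \<le> 0" if "t > 0" for t
    proof -
      have "F \<subseteq> max_face P c'"
        using \<open>c' \<in> normal_cone F P\<close> normal_cone_eq_max_face[OF subset] by blast
      then have "max_face P (c' + t *\<^sub>R c) = F"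
        using face(2) F_eq max_face_add[of P c' "t *\<^sub>R c"] max_face_scaleR[OF that, of P c] by auto
      then show ?thesis
        using open_le by (auto simp: open_normal_cone_def inner_add_left)
    qed
    have "((\<lambda>t. c' \<bullet> x + t * (c \<bullet> x)) \<longlongrightarrow> c' \<bullet> x + 0 * (c \<bullet> x)) (at_right 0)"
      by (intro tendsto_intros)
    moreover have "\<forall>\<^sub>F t in at_right 0. c' \<bullet> x + t * (c \<bullet> x) \<le> 0"
      using perturbed by (auto simp: eventually_at_right_field intro: exI[of _ 1])
    ultimately show ?thesis
      using tendsto_upperbound[of _ _ "at_right (0::real)" 0] by simp
  qed
  then show "x \<in> tangent_cone F P"
    using tangent_cone_iff_normal_cone[OF polytope face] by blast
qed

lemma lin_space_eq_orthogonal_comp_open_normal_cone: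
  fixes P :: "'a::euclidean_space set"
  assumes polytope: "polytope P" and face: "F face_of P" "F \<noteq> {}"
  shows "lin_space F = (open_normal_cone F P)\<^sup>\<bottom>"
proof
  have subset: "F \<subseteq> P"
    using face(1) by (rule face_of_imp_subset)
  have "open_normal_cone F P \<subseteq> (lin_space F)\<^sup>\<bottom>"
    using open_normal_cone_subset[OF subset] normal_cone_subset_orthogonal_comp[OF subset] by blast
  then show "lin_space F \<subseteq> (open_normal_cone F P)\<^sup>\<bottom>"
    using orthogonal_comp_subset orthogonal_comp_anti_mono by blast
  show "(open_normal_cone F P)\<^sup>\<bottom> \<subseteq> lin_space F"
  proof
    fix x assume "x \<in> (open_normal_cone F P)\<^sup>\<bottom>"
    then have "x \<in> tangent_cone F P" "- x \<in> tangent_cone F P"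
      by (auto simp: tangent_cone_iff_open_normal_cone[OF polytope face] orthogonal_comp_def
          orthogonal_def)
    then show "x \<in> lin_space F"
      by (rule tangent_cone_lineality[OF polytope_imp_convex[OF polytope] face])
  qed
qed

lemma parallel_faces_UNIV:
  fixes P :: "'a::euclidean_space set"
  assumes "convex P" "aff_dim P = int DIM('a)"
  shows "parallel_faces P UNIV = {P}"
proof -
  have "P \<noteq> {}"
    using assms(2) by auto
  have "lin_space F = UNIV \<longleftrightarrow> aff_dim F = int DIM('a)" if "F \<noteq> {}" for F :: "'a set"
    using aff_dim_eq_dim_lin_space[OF that] dim_eq_full[of "lin_space F"]
      lin_space_parallel(1)[OF that]
    by (metis of_nat_eq_iff span_eq_iff)
  then have "parallel_faces P UNIV = {F. F face_of P \<and> F \<noteq> {} \<and> aff_dim F = aff_dim P}"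
    unfolding parallel_faces_def assms(2) by blast
  also have "\<dots> = {P}"
    using face_of_aff_dim_lt[OF assms(1)] face_of_refl[OF assms(1)] \<open>P \<noteq> {}\<close> by force
  finally show ?thesis .
qed

lemma interior_angle_self:
  fixes P :: "'a::euclidean_space set"
  assumes angle: "cone_angle \<alpha>" and full_polytope: "polytope P" "aff_dim P = int DIM('a)"
  shows "interior_angle \<alpha> P P = 1"
proof -
  have convex: "convex P"
    using full_polytope(1) by (rule polytope_imp_convex)
  then have "P \<in> parallel_faces P UNIV"
    using parallel_faces_UNIV full_polytope(2) by blast
  then have face: "P face_of P" "P \<noteq> {}" and "lin_space P = UNIV"
    by (auto simp: parallel_faces_def)
  then have "normal_cone P P \<subseteq> {0}"
    using normal_cone_subset_orthogonal_comp[of P P] by simp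
  then have "tangent_cone P P = UNIV"
    using tangent_cone_iff_normal_cone[OF full_polytope(1) face] by fastforce
  then show ?thesis
    using angle by (simp add: interior_angle_def cone_angle_def)
qed

section \<open>Orthogonal projections\<close>

lemma closest_point_subspace:
  fixes V :: "'a::euclidean_space set"
  assumes "subspace V"
  shows "closest_point V x \<in> V" and "x - closest_point V x \<in> V\<^sup>\<bottom>"
proof -
  let ?p = "closest_point V x"
  show in_V: "?p \<in> V"
    using assms by (intro closest_point_in_set closed_subspace) (auto dest: subspace_0)
  have "(x - ?p) \<bullet> w \<le> 0" if "w \<in> V" for w
    using closest_point_dot[of V "?p + w" x] subspace_add[OF assms in_V that]
      subspace_imp_convex[OF assms] closed_subspace[OF assms] by simp
  from this this[OF subspace_neg[OF assms]] have "(x - ?p) \<bullet> w = 0" if "w \<in> V" for w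
    using that by (intro antisym) auto
  then show "x - ?p \<in> V\<^sup>\<bottom>"
    by (simp add: orthogonal_comp_def orthogonal_def inner_commute)
qed

lemma closest_point_subspace_eqI:
  fixes V :: "'a::euclidean_space set"
  assumes subspace: "subspace V" and decomposition: "y \<in> V" "x - y \<in> V\<^sup>\<bottom>"
  shows "closest_point V x = y"
proof -
  let ?p = "closest_point V x"
  have "?p - y \<in> V"
    by (rule subspace_diff[OF subspace closest_point_subspace(1)[OF subspace] decomposition(1)])
  moreover have "(x - y) - (x - ?p) \<in> V\<^sup>\<bottom>"
    by (rule subspace_diff[OF subspace_orthogonal_comp decomposition(2)
          closest_point_subspace(2)[OF subspace]])
  ultimately have "?p - y \<in> V \<inter> V\<^sup>\<bottom>"
    by simp
  then show ?thesis
    using orthogonal_Int_0[OF subspace] by simp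
qed

lemma closest_point_subspace_self_adjoint:
  fixes V :: "'a::euclidean_space set"
  assumes "subspace V"
  shows "closest_point V x \<bullet> y = x \<bullet> closest_point V y"
proof -
  have "closest_point V x \<bullet> (y - closest_point V y) = 0" for x y
    using closest_point_subspace[OF assms] by (auto simp: orthogonal_comp_def orthogonal_def)
  from this[of x y] this[of y x] show ?thesis
    by (simp add: inner_diff_right inner_commute)
qed

lemma negligible_closest_point_hyperplane:
  fixes V :: "'a::euclidean_space set"
  assumes "subspace V" "a \<notin> V\<^sup>\<bottom>"
  shows "negligible {x. a \<bullet> closest_point V x = 0}"
proof -
  have "closest_point V a \<noteq> 0"
    using closest_point_subspace(2)[OF assms(1), of a] assms(2) by auto
  then have "negligible {x. closest_point V a \<bullet> x = 0}"
    by (simp add: negligible_hyperplane)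
  then show ?thesis
    by (simp add: closest_point_subspace_self_adjoint[OF assms(1)])
qed

lemma polyhedral_cone_vimage_closest_point:
  fixes C V :: "'a::euclidean_space set"
  assumes "subspace V" "polyhedral_cone C"
  shows "polyhedral_cone (closest_point V -` C)"
proof -
  obtain N where normals: "finite N" "C = {x. \<forall>a\<in>N. a \<bullet> x \<le> 0}"
    using assms(2) polyhedral_cone_iff by blast
  have "closest_point V -` C = {x. \<forall>a\<in>closest_point V ` N. a \<bullet> x \<le> 0}"
    by (auto simp: normals(2) closest_point_subspace_self_adjoint[OF assms(1)])
  with normals(1) show ?thesis
    unfolding polyhedral_cone_iff by (intro exI[of _ "closest_point V ` N"] conjI) simp
qed

lemma set_plus_subspace_eq_vimage_closest_point:
  fixes N U :: "'a::euclidean_space set"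
  assumes subspace: "subspace U" and orthogonal: "N \<subseteq> U\<^sup>\<bottom>"
  shows "N + U = closest_point (U\<^sup>\<bottom>) -` N"
proof (intro subset_antisym subsetI)
  fix x assume "x \<in> N + U"
  then obtain n u where "x = n + u" "n \<in> N" "u \<in> U"
    by (rule set_plus_elim)
  then have "closest_point (U\<^sup>\<bottom>) x = n"
    using orthogonal orthogonal_comp_subset
    by (intro closest_point_subspace_eqI subspace_orthogonal_comp) auto
  with \<open>n \<in> N\<close> show "x \<in> closest_point (U\<^sup>\<bottom>) -` N"
    by simp
next
  fix x assume "x \<in> closest_point (U\<^sup>\<bottom>) -` N"
  moreover have "x - closest_point (U\<^sup>\<bottom>) x \<in> U"
    using closest_point_subspace(2)[OF subspace_orthogonal_comp, of x U]
      orthogonal_comp_self[OF subspace]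
    by simp
  ultimately have "closest_point (U\<^sup>\<bottom>) x + (x - closest_point (U\<^sup>\<bottom>) x) \<in> N + U"
    by (intro set_plus_intro) auto
  then show "x \<in> N + U"
    by simp
qed

section \<open>Belt polytopes\<close>

locale belt_polytope =
  fixes P G :: "'a::euclidean_space set"
  assumes polytope: "polytope P" and nonempty: "P \<noteq> {}" and finite_G: "finite G"
    and open_normal_cone_max_face: "open_normal_cone (max_face P c) P = cell G c"
begin

lemma nonempty_faces: "{F. F face_of P \<and> F \<noteq> {}} = range (max_face P)"
  using polytope nonempty by (rule nonempty_faces_eq_range_max_face)

lemma max_face_face: "max_face P c face_of P" "max_face P c \<noteq> {}"
  using nonempty_faces by blast+

lemma lin_space_max_face: "lin_space (max_face P c) = span {g \<in> G. g \<bullet> c = 0}"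
  by (simp only: lin_space_eq_orthogonal_comp_open_normal_cone[OF polytope max_face_face]
      open_normal_cone_max_face orthogonal_comp_cell[OF finite_G])

lemma flats_eq_range_span: "flats P = range (\<lambda>c. span {g \<in> G. g \<bullet> c = 0})"
proof -
  have "flats P = lin_space ` {F. F face_of P \<and> F \<noteq> {}}"
    by (auto simp: flats_def)
  then show ?thesis
    by (simp only: nonempty_faces image_image lin_space_max_face)
qed

lemma negligible_projection_not_generic:
  assumes "subspace U"
  shows "negligible {x. {g \<in> G. g \<bullet> closest_point (U\<^sup>\<bottom>) x = 0} \<noteq> G \<inter> U}"
proof -
  have "g \<bullet> closest_point (U\<^sup>\<bottom>) x = 0" if "g \<in> U" for g x
    using closest_point_subspace(1)[OF subspace_orthogonal_comp, of U x] that
    by (auto simp: orthogonal_comp_def orthogonal_def)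
  then have "{x. {g \<in> G. g \<bullet> closest_point (U\<^sup>\<bottom>) x = 0} \<noteq> G \<inter> U}
      \<subseteq> (\<Union>g\<in>G - U. {x. g \<bullet> closest_point (U\<^sup>\<bottom>) x = 0})"
    by blast
  moreover have "negligible (\<Union>g\<in>G - U. {x. g \<bullet> closest_point (U\<^sup>\<bottom>) x = 0})"
    using finite_G by (auto intro!: negligible_Union negligible_closest_point_hyperplane
        simp: subspace_orthogonal_comp orthogonal_comp_self[OF assms])
  ultimately show ?thesis
    by (rule negligible_subset[rotated])
qed

lemma flats_iff: "U \<in> flats P \<longleftrightarrow> span (G \<inter> U) = U"
proof
  assume "U \<in> flats P"
  then obtain c where U_eq: "U = span {g \<in> G. g \<bullet> c = 0}"
    unfolding flats_eq_range_span by blast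
  have "U \<subseteq> span (G \<inter> U)"
    unfolding U_eq by (intro span_mono) (auto intro: span_base)
  moreover have "span (G \<inter> U) \<subseteq> U"
    unfolding U_eq by (intro span_minimal) auto
  ultimately show "span (G \<inter> U) = U" by blast
next
  assume spanned: "span (G \<inter> U) = U"
  then have "subspace U"
    by (metis subspace_span)
  then have "negligible {x. {g \<in> G. g \<bullet> closest_point (U\<^sup>\<bottom>) x = 0} \<noteq> G \<inter> U}" (is "negligible ?B")
    by (rule negligible_projection_not_generic)
  moreover have "\<not> negligible (UNIV :: 'a set)"
    by (intro open_not_negligible) auto
  ultimately have "?B \<noteq> UNIV"
    by metis
  then obtain x where "{g \<in> G. g \<bullet> closest_point (U\<^sup>\<bottom>) x = 0} = G \<inter> U"
    by blast
  with spanned have "U = span {g \<in> G. g \<bullet> closest_point (U\<^sup>\<bottom>) x = 0}"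
    by simp
  then show "U \<in> flats P"
    unfolding flats_eq_range_span by blast
qed

lemma span_in_flats: "B \<subseteq> G \<Longrightarrow> span B \<in> flats P"
  unfolding flats_iff
  by (intro subset_antisym span_minimal span_mono) (auto intro: span_base)

lemma orthogonal_comp_flat_iff:
  assumes "U \<in> flats P"
  shows "c \<in> U\<^sup>\<bottom> \<longleftrightarrow> U \<subseteq> lin_space (max_face P c)"
proof
  assume "c \<in> U\<^sup>\<bottom>"
  then have "G \<inter> U \<subseteq> {g \<in> G. g \<bullet> c = 0}"
    by (auto simp: orthogonal_comp_def orthogonal_def)
  then have "span (G \<inter> U) \<subseteq> lin_space (max_face P c)"
    unfolding lin_space_max_face by (rule span_mono)
  then show "U \<subseteq> lin_space (max_face P c)"
    using assms flats_iff by blast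
next
  assume "U \<subseteq> lin_space (max_face P c)"
  then have "(lin_space (max_face P c))\<^sup>\<bottom> \<subseteq> U\<^sup>\<bottom>"
    by (rule orthogonal_comp_anti_mono)
  moreover have "c \<in> (lin_space (max_face P c))\<^sup>\<bottom>"
    unfolding lin_space_max_face orthogonal_comp_span
    by (simp add: orthogonal_comp_def orthogonal_def)
  ultimately show "c \<in> U\<^sup>\<bottom>" by blast
qed

lemma exterior_cone_eq:
  assumes "F \<in> parallel_faces P U"
  shows "normal_cone F P + lin_space F = closest_point (U\<^sup>\<bottom>) -` normal_cone F P"
proof -
  have face: "F face_of P" "F \<noteq> {}" and lin_space_F: "lin_space F = U"
    using assms by (auto simp: parallel_faces_def)
  have "subspace U"
    using lin_space_parallel(1)[OF face(2)] lin_space_F by simp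
  moreover have "normal_cone F P \<subseteq> U\<^sup>\<bottom>"
    using normal_cone_subset_orthogonal_comp[OF face_of_imp_subset[OF face(1)]] lin_space_F by simp
  ultimately show ?thesis
    unfolding lin_space_F by (rule set_plus_subspace_eq_vimage_closest_point)
qed

lemma exterior_cones_tile:
  assumes flat: "U \<in> flats P" and generic: "{g \<in> G. g \<bullet> closest_point (U\<^sup>\<bottom>) x = 0} = G \<inter> U"
  shows "\<exists>!F. F \<in> parallel_faces P U \<and> x \<in> normal_cone F P + lin_space F"
proof
  let ?M = "max_face P (closest_point (U\<^sup>\<bottom>) x)"
  have M_parallel: "?M \<in> parallel_faces P U"
    using max_face_face flat generic by (simp add: parallel_faces_def lin_space_max_face flats_iff)
  have mem_iff: "x \<in> normal_cone F P + lin_space F \<longleftrightarrow> F \<subseteq> ?M"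
    if parallel: "F \<in> parallel_faces P U" for F
  proof -
    have "F \<subseteq> P"
      using parallel face_of_imp_subset by (auto simp: parallel_faces_def)
    then show ?thesis
      unfolding exterior_cone_eq[OF parallel] by (simp add: normal_cone_eq_max_face)
  qed
  show "?M \<in> parallel_faces P U \<and> x \<in> normal_cone ?M P + lin_space ?M"
    using M_parallel mem_iff by blast
  show "F = ?M" if "F \<in> parallel_faces P U \<and> x \<in> normal_cone F P + lin_space F" for F
    using that M_parallel mem_iff parallel_faces_incomparable by blast
qed

lemma exterior_angle_sum_parallel_faces:
  assumes angle: "cone_angle \<alpha>" and flat: "U \<in> flats P"
  shows "(\<Sum>F\<in>parallel_faces P U. exterior_angle \<alpha> F P) = 1"
  unfolding exterior_angle_def
proof (rule cone_angle_tiling[OF angle])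
  show "finite (parallel_faces P U)"
    using finite_polytope_faces[OF polytope]
    by (rule rev_finite_subset) (auto simp: parallel_faces_def)
  show "polyhedral_cone (normal_cone F P + lin_space F)" if parallel: "F \<in> parallel_faces P U" for F
    unfolding exterior_cone_eq[OF parallel] using parallel polytope face_of_polytope_polytope
    by (intro polyhedral_cone_vimage_closest_point subspace_orthogonal_comp
        polyhedral_cone_normal_cone) (auto simp: parallel_faces_def)
  show "negligible {x. \<not> (\<exists>!F. F \<in> parallel_faces P U \<and> x \<in> normal_cone F P + lin_space F)}"
    using exterior_cones_tile[OF flat]
    by (intro negligible_subset[OF negligible_projection_not_generic[OF subspace_flat[OF flat]]])
      blast
qed

lemma sum_euler_char_open_normal_cones:
  assumes "rel_open S" "convex S"
  shows "(\<Sum>F | F face_of P \<and> F \<noteq> {}. euler_char (S \<inter> open_normal_cone F P)) = euler_char S"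
proof -
  have inj: "inj_on (\<lambda>F. open_normal_cone F P) (range (max_face P))"
    by (intro inj_onI) (auto simp: open_normal_cone_def)
  have "range (cell G) = (\<lambda>F. open_normal_cone F P) ` range (max_face P)"
    by (simp only: image_image open_normal_cone_max_face)
  then show ?thesis
    using sum_euler_char_cells[OF finite_G assms]
    by (simp only: nonempty_faces sum.reindex[OF inj] o_def)
qed

lemma convex_open_normal_cone:
  assumes "F face_of P" "F \<noteq> {}"
  shows "convex (open_normal_cone F P)"
proof -
  obtain c where "F = max_face P c"
    using assms nonempty_faces by blast
  then show ?thesis
    by (simp add: open_normal_cone_max_face convex_cell[OF finite_G])
qed

lemma euler_char_open_normal_cone:
  assumes "F face_of P" "F \<noteq> {}"
  shows "euler_char (open_normal_cone F P) = (-1) ^ (DIM('a) - dim (lin_space F))"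
proof -
  obtain c where "F = max_face P c"
    using assms nonempty_faces by blast
  then show ?thesis
    by (simp add: open_normal_cone_max_face euler_char_cell[OF finite_G] lin_space_max_face)
qed

lemma euler_char_open_normal_cone_diff_halfspace:
  assumes face: "F face_of P" "F \<noteq> {}"
  shows "euler_char (open_normal_cone F P) - euler_char (open_normal_cone F P \<inter> {y. x \<bullet> y > 0})
    = (-1) ^ (DIM('a) - dim (lin_space F)) * indicator (tangent_cone F P) x"
proof (cases "open_normal_cone F P \<inter> {y. x \<bullet> y > 0} = {}")
  case True
  then have "x \<in> tangent_cone F P"
    unfolding tangent_cone_iff_open_normal_cone[OF polytope face]
    by (force simp: inner_commute not_less)
  with True show ?thesis
    by (simp add: euler_char_open_normal_cone[OF face])
next
  case False
  then have "x \<notin> tangent_cone F P"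
    unfolding tangent_cone_iff_open_normal_cone[OF polytope face]
    by (force simp: inner_commute not_less)
  with False show ?thesis
    by (simp add: euler_char_Int_open[OF convex_open_normal_cone[OF face] open_halfspace_gt])
qed

lemma euler_char_flat_Int_open_normal_cone_diff_halfspace:
  assumes flat: "U \<in> flats P" and face: "F face_of P" "F \<noteq> {}"
  shows "euler_char (U\<^sup>\<bottom> \<inter> open_normal_cone F P)
      - euler_char (U\<^sup>\<bottom> \<inter> {y. x \<bullet> y > 0} \<inter> open_normal_cone F P)
    = (if U \<subseteq> lin_space F
       then (-1) ^ (DIM('a) - dim (lin_space F)) * indicator (tangent_cone F P) x else 0)"
    (is "euler_char (_ \<inter> ?\<tau>) - euler_char (_ \<inter> ?R \<inter> _) = _")
proof (cases "U \<subseteq> lin_space F")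
  case True
  then have "?\<tau> \<subseteq> U\<^sup>\<bottom>"
    using orthogonal_comp_flat_iff[OF flat] by (auto simp: open_normal_cone_def)
  then have "U\<^sup>\<bottom> \<inter> ?\<tau> = ?\<tau>" "U\<^sup>\<bottom> \<inter> ?R \<inter> ?\<tau> = ?\<tau> \<inter> ?R"
    by blast+
  with True show ?thesis
    by (simp only: euler_char_open_normal_cone_diff_halfspace[OF face] if_True)
next
  case False
  then have "U\<^sup>\<bottom> \<inter> ?\<tau> = {}"
    using orthogonal_comp_flat_iff[OF flat] by (auto simp: open_normal_cone_def)
  then have "U\<^sup>\<bottom> \<inter> ?\<tau> = {}" "U\<^sup>\<bottom> \<inter> ?R \<inter> ?\<tau> = {}"
    by blast+
  with False show ?thesis
    by simp
qed

lemma alternating_sum_tangent_cones: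
  assumes flat: "U \<in> flats P" and orthogonal: "w \<in> U\<^sup>\<bottom>" "w \<bullet> x \<noteq> 0"
  shows "(\<Sum>F | F face_of P \<and> F \<noteq> {} \<and> U \<subseteq> lin_space F.
    (-1) ^ (DIM('a) - dim (lin_space F)) * indicator (tangent_cone F P) x) = (0::real)"
proof -
  let ?\<tau> = "\<lambda>F. open_normal_cone F P" and ?R = "{y. x \<bullet> y > 0}"
  have subspace: "subspace (U\<^sup>\<bottom>)"
    by (rule subspace_orthogonal_comp)
  then have comp_rel_open: "rel_open (U\<^sup>\<bottom>)" "convex (U\<^sup>\<bottom>)"
    by (auto intro: affine_rel_open subspace_imp_affine subspace_imp_convex)
  then have half_rel_open: "rel_open (U\<^sup>\<bottom> \<inter> ?R)" "convex (U\<^sup>\<bottom> \<inter> ?R)"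
    using rel_open_Int[OF comp_rel_open(2,1) convex_halfspace_gt
        rel_open_open[OF open_halfspace_gt]]
    by (auto intro: convex_Int convex_halfspace_gt)
  have "U\<^sup>\<bottom> \<inter> ?R \<noteq> {}"
    using orthogonal subspace_neg[OF subspace orthogonal(1)]
    by (cases "w \<bullet> x > 0") (force simp: inner_commute)+
  then have euler_R: "euler_char (U\<^sup>\<bottom> \<inter> ?R) = euler_char (U\<^sup>\<bottom>)"
    by (rule euler_char_Int_open[OF comp_rel_open(2) open_halfspace_gt])
  have "0 = (\<Sum>F | F face_of P \<and> F \<noteq> {}. euler_char (U\<^sup>\<bottom> \<inter> ?\<tau> F) - euler_char (U\<^sup>\<bottom> \<inter> ?R \<inter> ?\<tau> F))"
    by (simp add: sum_subtractf sum_euler_char_open_normal_cones[OF comp_rel_open]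
        sum_euler_char_open_normal_cones[OF half_rel_open] euler_R)
  also have "\<dots> = (\<Sum>F | F face_of P \<and> F \<noteq> {}. if U \<subseteq> lin_space F
      then (-1) ^ (DIM('a) - dim (lin_space F)) * indicator (tangent_cone F P) x else 0)"
    by (intro sum.cong) (simp_all add: euler_char_flat_Int_open_normal_cone_diff_halfspace[OF flat])
  also have "\<dots> = (\<Sum>F | F face_of P \<and> F \<noteq> {} \<and> U \<subseteq> lin_space F.
      (-1) ^ (DIM('a) - dim (lin_space F)) * indicator (tangent_cone F P) x)"
    using finite_polytope_faces[OF polytope]
    by (subst sum.inter_filter[symmetric]) (simp_all add: conj_assoc)
  finally show ?thesis by simp
qed

lemma alternating_sum_interior_angles:
  assumes angle: "cone_angle \<alpha>" and proper_flat: "U \<in> flats P" "U \<noteq> UNIV"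
  shows "(\<Sum>F | F face_of P \<and> F \<noteq> {} \<and> U \<subseteq> lin_space F.
    (-1) ^ (DIM('a) - dim (lin_space F)) * interior_angle \<alpha> F P) = 0"
proof -
  have "U\<^sup>\<bottom> \<noteq> {0}"
    using orthogonal_comp_self[OF subspace_flat[OF proper_flat(1)]] proper_flat(2) by force
  then obtain w where orthogonal: "w \<in> U\<^sup>\<bottom>" "w \<noteq> 0"
    using subspace_0[OF subspace_orthogonal_comp, of U] by blast
  show ?thesis
    unfolding interior_angle_def
  proof (rule cone_angle_linear_relation[OF angle])
    show "finite {F. F face_of P \<and> F \<noteq> {} \<and> U \<subseteq> lin_space F}"
      using finite_polytope_faces[OF polytope] by (rule rev_finite_subset) blast
    show "polyhedral_cone (tangent_cone F P)" for F
      by (rule polyhedral_cone_tangent_cone[OF polytope])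
    show "negligible {x. (\<Sum>F | F face_of P \<and> F \<noteq> {} \<and> U \<subseteq> lin_space F.
        (-1) ^ (DIM('a) - dim (lin_space F)) * indicator (tangent_cone F P) x) \<noteq> (0::real)}"
      using alternating_sum_tangent_cones[OF proper_flat(1) orthogonal(1)] orthogonal(2)
      by (intro negligible_subset[OF negligible_hyperplane[of w 0]]) auto
  qed
qed

end

section \<open>Zonotopes are belt polytopes\<close>

lemma set_plus_mem_max_face_iff:
  assumes "a \<in> A" "b \<in> B"
  shows "a + b \<in> max_face (A + B) c \<longleftrightarrow> a \<in> max_face A c \<and> b \<in> max_face B c"
proof
  assume "a + b \<in> max_face (A + B) c"
  then have "c \<bullet> (a' + b') \<le> c \<bullet> (a + b)" if "a' \<in> A" "b' \<in> B" for a' b'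
    using that by (auto simp: max_face_def)
  from this[OF _ \<open>b \<in> B\<close>] this[OF \<open>a \<in> A\<close>] show "a \<in> max_face A c \<and> b \<in> max_face B c"
    using assms by (auto simp: max_face_def inner_add_right)
next
  assume "a \<in> max_face A c \<and> b \<in> max_face B c"
  then show "a + b \<in> max_face (A + B) c"
    by (auto simp: max_face_def inner_add_right elim!: set_plus_elim intro!: add_mono)
qed

lemma max_face_set_plus_eq_iff:
  assumes A_compact: "compact A" "A \<noteq> {}" and B_compact: "compact B" "B \<noteq> {}"
  shows "max_face (A + B) c = max_face (A + B) c' \<longleftrightarrow>
    max_face A c = max_face A c' \<and> max_face B c = max_face B c'"
proof -
  have subset: "max_face A c \<subseteq> max_face A c' \<and> max_face B c \<subseteq> max_face B c'"
    if "max_face (A + B) c \<subseteq> max_face (A + B) c'" for c c'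
  proof -
    have "a \<in> max_face A c' \<and> b \<in> max_face B c'" if "a \<in> max_face A c" "b \<in> max_face B c" for a b
    proof -
      have "a \<in> A" "b \<in> B"
        using that by (auto simp: max_face_def)
      then show ?thesis
        using that \<open>max_face (A + B) c \<subseteq> max_face (A + B) c'\<close> set_plus_mem_max_face_iff by blast
    qed
    then show ?thesis
      using max_face_nonempty[OF A_compact, of c] max_face_nonempty[OF B_compact, of c] by blast
  qed
  have "max_face (A + B) c = max_face (A + B) c'"
    if "max_face A c = max_face A c'" "max_face B c = max_face B c'"
  proof -
    have "a + b \<in> max_face (A + B) c \<longleftrightarrow> a + b \<in> max_face (A + B) c'" if "a \<in> A" "b \<in> B" for a b
      by (simp only: set_plus_mem_max_face_iff[OF \<open>a \<in> A\<close> \<open>b \<in> B\<close>] that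
          \<open>max_face A c = max_face A c'\<close> \<open>max_face B c = max_face B c'\<close>)
    then have "x \<in> max_face (A + B) c \<longleftrightarrow> x \<in> max_face (A + B) c'" if "x \<in> A + B" for x
      using that by (blast elim: set_plus_elim)
    then show ?thesis
      using max_face_subset by blast
  qed
  then show ?thesis
    using subset[of c c'] subset[of c' c] by blast
qed

lemma polytope_set_plus: "polytope A \<Longrightarrow> polytope B \<Longrightarrow> polytope (A + B)"
  for A B :: "'a::euclidean_space set"
  unfolding polytope_def by (metis convex_hull_set_plus finite_set_plus)

lemma set_plus_nonempty: "A \<noteq> {} \<Longrightarrow> B \<noteq> {} \<Longrightarrow> A + B \<noteq> {}"
  by (auto simp: set_plus_def)

lemma polytope_set_sum:
  fixes S :: "'i \<Rightarrow> 'a::euclidean_space set"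
  assumes "\<And>k. k \<in> K \<Longrightarrow> polytope (S k)"
  shows "polytope (\<Sum>k\<in>K. S k)"
  using assms
  by (induction K rule: infinite_finite_induct)
    (auto simp: polytope_set_plus set_zero polytope_sing)

lemma set_sum_nonempty: "(\<And>k. k \<in> K \<Longrightarrow> S k \<noteq> {}) \<Longrightarrow> (\<Sum>k\<in>K. S k) \<noteq> {}"
  by (induction K rule: infinite_finite_induct) (auto simp: set_plus_nonempty)

lemma max_face_set_sum_eq_iff:
  fixes S :: "'i \<Rightarrow> 'a::euclidean_space set"
  assumes "finite K" and "\<And>k. k \<in> K \<Longrightarrow> polytope (S k) \<and> S k \<noteq> {}"
  shows "max_face (\<Sum>k\<in>K. S k) c = max_face (\<Sum>k\<in>K. S k) c' \<longleftrightarrow>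
      (\<forall>k\<in>K. max_face (S k) c = max_face (S k) c')"
  using assms
proof (induction K rule: finite_induct)
  case empty
  then show ?case by (simp add: set_zero)
next
  case (insert k K)
  have "polytope (\<Sum>k\<in>K. S k)" "(\<Sum>k\<in>K. S k) \<noteq> {}"
    using insert.prems by (auto intro!: polytope_set_sum set_sum_nonempty)
  then show ?case
    using insert by (simp add: max_face_set_plus_eq_iff polytope_imp_compact)
qed

lemma max_face_closed_segment:
  "max_face (closed_segment a b) c =
    (if 0 < (b - a) \<bullet> c then {b} else if (b - a) \<bullet> c < 0 then {a} else closed_segment a b)"
proof -
  define \<gamma> where "\<gamma> u = a + u *\<^sub>R (b - a)" for u
  let ?d = "(b - a) \<bullet> c"
  have segment: "closed_segment a b = \<gamma> ` {0..1}"
    by (simp add: \<gamma>_def closed_segment_image_interval algebra_simps)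
  have "c \<bullet> \<gamma> u = c \<bullet> a + u * ?d" for u
    by (simp add: \<gamma>_def inner_add_right inner_commute)
  then have face: "max_face (closed_segment a b) c = \<gamma> ` {u \<in> {0..1}. \<forall>v\<in>{0..1}. v * ?d \<le> u * ?d}"
    unfolding max_face_def segment by auto
  consider (positive) "0 < ?d" | (negative) "?d < 0" | (zero) "?d = 0"
    by linarith
  then show ?thesis
  proof cases
    case positive
    then have "{u \<in> {0..1}. \<forall>v\<in>{0..1}. v * ?d \<le> u * ?d} = {1}"
      by (auto intro: antisym)
    with positive face show ?thesis by (simp add: \<gamma>_def)
  next
    case negative
    then have "{u \<in> {0..1}. \<forall>v\<in>{0..1}. v * ?d \<le> u * ?d} = {0}"
      by (auto intro: antisym)
    with negative face show ?thesis by (simp add: \<gamma>_def)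
  next
    case zero
    then have "{u \<in> {0..1}. \<forall>v\<in>{0..1}. v * ?d \<le> u * ?d} = {0..1}"
      by auto
    with zero face show ?thesis by (simp add: segment)
  qed
qed

lemma max_face_closed_segment_eq_iff:
  "max_face (closed_segment a b) c = max_face (closed_segment a b) c' \<longleftrightarrow>
    sgn ((b - a) \<bullet> c) = sgn ((b - a) \<bullet> c')"
proof (cases "a = b")
  case False
  then have "closed_segment a b \<noteq> {a}" "closed_segment a b \<noteq> {b}"
    using ends_in_segment by fastforce+
  with False show ?thesis
    by (auto simp: max_face_closed_segment sgn_real_def)
qed simp

lemma belt_polytope_sum_segments:
  fixes a b :: "'i \<Rightarrow> 'a::euclidean_space"
  assumes "finite K"
  shows "belt_polytope (\<Sum>k\<in>K. closed_segment (a k) (b k)) ((\<lambda>k. b k - a k) ` K)"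
    (is "belt_polytope ?Z ?G")
proof
  show "polytope ?Z"
    by (intro polytope_set_sum) (simp add: segment_convex_hull polytope_convex_hull)
  show "?Z \<noteq> {}"
    by (intro set_sum_nonempty) simp
  show "finite ?G"
    using assms by simp
  have "max_face ?Z c' = max_face ?Z c \<longleftrightarrow> (\<forall>k\<in>K. sgn ((b k - a k) \<bullet> c') = sgn ((b k - a k) \<bullet> c))"
    for c c'
    by (subst max_face_set_sum_eq_iff[OF assms])
      (simp_all add: segment_convex_hull polytope_convex_hull flip: max_face_closed_segment_eq_iff)
  then show "open_normal_cone (max_face ?Z c) ?Z = cell ?G c" for c
    by (auto simp: open_normal_cone_def cell_def)
qed

section \<open>The lattice of flats\<close>

lemma card_chain_le_rank_function:
  fixes \<rho> :: "'b \<Rightarrow> nat"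
  assumes mono: "\<And>a b. \<lbrakk>(a, b) \<in> r; a \<noteq> b\<rbrakk> \<Longrightarrow> \<rho> a < \<rho> b"
    and chain: "C \<in> Chains r" "C \<subseteq> under r a"
  shows "card C \<le> Suc (\<rho> a)"
proof -
  have "inj_on \<rho> C"
  proof (rule inj_onI)
    fix b c assume "b \<in> C" "c \<in> C" "\<rho> b = \<rho> c"
    then show "b = c"
      using chain(1) mono[of b c] mono[of c b] by (auto simp: Chains_def)
  qed
  moreover have "\<rho> ` C \<subseteq> {..\<rho> a}"
  proof (rule image_subsetI)
    fix b assume "b \<in> C"
    then show "\<rho> b \<in> {..\<rho> a}"
      using chain(2) mono[of b a] by (cases "b = a") (auto simp: under_def intro: less_imp_le)
  qed
  ultimately have "card C \<le> card {..\<rho> a}"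
    by (intro card_inj_on_le) auto
  then show ?thesis by simp
qed

lemma chain_of_rank_function:
  fixes \<rho> :: "'b \<Rightarrow> nat"
  assumes partial_order: "Partial_order r"
    and mono: "\<And>a b. \<lbrakk>(a, b) \<in> r; a \<noteq> b\<rbrakk> \<Longrightarrow> \<rho> a < \<rho> b"
    and cover: "\<And>b. \<lbrakk>b \<in> Field r; 0 < \<rho> b\<rbrakk> \<Longrightarrow> \<exists>a. (a, b) \<in> r \<and> \<rho> b = Suc (\<rho> a)"
    and "b \<in> Field r"
  shows "\<exists>C\<in>Chains r. C \<subseteq> under r b \<and> card C = Suc (\<rho> b)"
  using \<open>b \<in> Field r\<close>
proof (induction "\<rho> b" arbitrary: b)
  case 0
  then have "(b, b) \<in> r"
    using partial_order by (auto simp: partial_order_on_def preorder_on_def refl_on_def)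
  with 0 show ?case
    by (intro bexI[of _ "{b}"]) (auto simp: Chains_def under_def)
next
  case (Suc n)
  have "trans r" and b_refl: "(b, b) \<in> r"
    using partial_order Suc.prems by (auto simp: partial_order_on_def preorder_on_def refl_on_def)
  obtain a where covered: "(a, b) \<in> r" "\<rho> b = Suc (\<rho> a)"
    using cover[OF Suc.prems] Suc.hyps(2) by auto
  then have "n = \<rho> a" "a \<in> Field r"
    using Suc.hyps(2) by (auto simp: Field_def)
  then obtain C where chain: "C \<in> Chains r" "C \<subseteq> under r a" "card C = Suc (\<rho> a)"
    using Suc.hyps(1) by blast
  have below: "(c, b) \<in> r" if "c \<in> C" for c
    using that chain(2) covered(1) \<open>trans r\<close> by (auto simp: under_def dest: transD)
  have "b \<notin> C"
    using mono[of b a] covered(2) chain(2) by (cases "b = a") (auto simp: under_def)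
  moreover have "finite C"
    using chain(3) card.infinite by fastforce
  ultimately have "card (insert b C) = Suc (\<rho> b)"
    using chain(3) covered(2) by simp
  then show ?case
    using chain(1) b_refl below by (intro bexI[of _ "insert b C"]) (auto simp: Chains_def under_def)
qed

lemma poset_rank_eq_rank_function:
  fixes \<rho> :: "'b \<Rightarrow> nat"
  assumes partial_order: "Partial_order r" and finite_Field: "finite (Field r)"
    and mono: "\<And>a b. \<lbrakk>(a, b) \<in> r; a \<noteq> b\<rbrakk> \<Longrightarrow> \<rho> a < \<rho> b"
    and cover: "\<And>b. \<lbrakk>b \<in> Field r; 0 < \<rho> b\<rbrakk> \<Longrightarrow> \<exists>a. (a, b) \<in> r \<and> \<rho> b = Suc (\<rho> a)"
    and in_Field: "b \<in> Field r"
  shows "poset_rank r b = \<rho> b"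
  unfolding poset_rank_def
proof (rule Max_eqI)
  have "{C \<in> Chains r. C \<subseteq> under r b} \<subseteq> Pow (Field r)"
    by (auto simp: under_def Field_def)
  then show "finite ((\<lambda>C. card C - 1) ` {C \<in> Chains r. C \<subseteq> under r b})"
    using finite_Field by (blast intro: finite_subset)
  show "k \<le> \<rho> b" if "k \<in> (\<lambda>C. card C - 1) ` {C \<in> Chains r. C \<subseteq> under r b}" for k
    using that card_chain_le_rank_function[of r \<rho> _ b, OF mono] by fastforce
  obtain C where "C \<in> Chains r" "C \<subseteq> under r b" "card C = Suc (\<rho> b)"
    using chain_of_rank_function[of r \<rho> b, OF partial_order mono cover in_Field] by blast
  then show "\<rho> b \<in> (\<lambda>C. card C - 1) ` {C \<in> Chains r. C \<subseteq> under r b}"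
    by force
qed

lemma card_under_less:
  assumes "finite (Field r)" "trans r" "antisym r" "(c, a) \<in> r" "c \<noteq> a" "(a, a) \<in> r"
  shows "card (under r c) < card (under r a)"
proof (rule psubset_card_mono)
  show "finite (under r a)"
    using assms(1) by (rule rev_finite_subset) (auto simp: under_def Field_def)
  have "under r c \<subseteq> under r a"
    using assms(2,4) by (auto simp: under_def dest: transD)
  moreover have "a \<in> under r a - under r c"
    using assms(3-6) by (auto simp: under_def dest: antisymD)
  ultimately show "under r c \<subset> under r a"
    by blast
qed

lemma of_int_moebius_eqI:
  fixes f :: "'b \<Rightarrow> 'c::ring_1"
  assumes finite_Field: "finite (Field r)" and partial_order: "Partial_order r" and "f z = 1"
    and interval_sum: "\<And>b. \<lbrakk>(z, b) \<in> r; b \<noteq> z\<rbrakk> \<Longrightarrow> (\<Sum>c | (z, c) \<in> r \<and> (c, b) \<in> r. f c) = 0"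
    and "(z, a) \<in> r"
  shows "of_int (moebius r z a) = f a"
  using \<open>(z, a) \<in> r\<close>
proof (induction "card (under r a)" arbitrary: a rule: less_induct)
  case less
  have order_a: "trans r" "antisym r" "(a, a) \<in> r"
    using partial_order less.prems
    by (auto simp: partial_order_on_def preorder_on_def refl_on_def Field_def)
  let ?S = "{c. (z, c) \<in> r \<and> (c, a) \<in> r \<and> c \<noteq> a}"
  show ?case
  proof (cases "a = z")
    case True
    then show ?thesis
      using finite_Field partial_order less.prems \<open>f z = 1\<close> by (simp add: moebius.simps)
  next
    case False
    have "of_int (moebius r z c) = f c" if "c \<in> ?S" for c
      using that less.hyps card_under_less[OF finite_Field order_a(1,2)] order_a(3) by blast
    then have "of_int (moebius r z a) = - (\<Sum>c\<in>?S. f c)"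
      using finite_Field partial_order less.prems False by (subst moebius.simps) simp
    also have "\<dots> = f a"
    proof -
      have "finite ?S"
        using finite_Field by (rule rev_finite_subset) (auto simp: Field_def)
      moreover have "{c. (z, c) \<in> r \<and> (c, a) \<in> r} = insert a ?S"
        using less.prems order_a(3) by auto
      ultimately have "f a + (\<Sum>c\<in>?S. f c) = 0"
        using interval_sum[OF less.prems False] by simp
      then show ?thesis
        by (simp add: neg_eq_iff_add_eq_0 add.commute)
    qed
    finally show ?thesis .
  qed
qed

lemma lattice_of_flats_iff:
  "(U, V) \<in> lattice_of_flats P \<longleftrightarrow> U \<in> flats P \<and> V \<in> flats P \<and> U \<subseteq> V"
  by (simp add: lattice_of_flats_def)

lemma Field_lattice_of_flats [simp]: "Field (lattice_of_flats P) = flats P"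
  by (auto simp: Field_def lattice_of_flats_def)

lemma partial_order_on_flats: "partial_order_on (flats P) (lattice_of_flats P)"
  by (auto simp: partial_order_on_def preorder_on_def refl_on_def trans_def antisym_def
      lattice_of_flats_def)

lemma poset_bot_converse_lattice_of_flats:
  "UNIV \<in> flats P \<Longrightarrow> poset_bot ((lattice_of_flats P)\<inverse>) = UNIV"
  unfolding poset_bot_def
  by (rule the_equality) (auto simp: lattice_of_flats_iff)

lemma UNIV_in_flats:
  fixes P :: "'a::euclidean_space set"
  assumes "convex P" "aff_dim P = int DIM('a)"
  shows "UNIV \<in> flats P"
  using parallel_faces_UNIV[OF assms] by (auto simp: parallel_faces_def flats_def)

lemma dim_flat_less:
  "\<lbrakk>(U, V) \<in> lattice_of_flats P; U \<noteq> V\<rbrakk> \<Longrightarrow> dim U < dim V"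
  by (metis dim_psubset lattice_of_flats_iff psubsetI span_eq_iff subspace_flat)

context belt_polytope
begin

lemma flat_covers_flat:
  assumes flat: "U \<in> flats P" and "0 < dim U"
  shows "\<exists>V\<in>flats P. V \<subseteq> U \<and> dim U = Suc (dim V)"
proof -
  obtain B where basis: "B \<subseteq> G \<inter> U" "independent B" "G \<inter> U \<subseteq> span B" "card B = dim (G \<inter> U)"
    using basis_exists[of "G \<inter> U"] by blast
  have dim_U: "dim U = card B"
    using flat basis(4) dim_span[of "G \<inter> U"] by (simp add: flats_iff)
  then obtain b where b_in_basis: "b \<in> B"
    using \<open>0 < dim U\<close> by fastforce
  let ?V = "span (B - {b})"
  have "?V \<in> flats P"
    using basis(1) by (intro span_in_flats) blast
  moreover have "?V \<subseteq> U"
    using basis(1) by (intro span_minimal subspace_flat[OF flat]) blast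
  moreover have "dim ?V = card B - 1"
    using dim_span_eq_card_independent[OF independent_mono[OF basis(2) Diff_subset]] b_in_basis
    by simp
  ultimately show ?thesis
    using dim_U \<open>0 < dim U\<close> by auto
qed

lemma flat_covered_by_flat:
  assumes UNIV_flat: "UNIV \<in> flats P" and lower_flat: "U \<in> flats P" "dim U < DIM('a)"
  shows "\<exists>V\<in>flats P. U \<subseteq> V \<and> dim V = Suc (dim U)"
proof -
  have span_U: "span (G \<inter> U) = U" and span_G: "span G = UNIV"
    using UNIV_flat lower_flat(1) by (simp_all add: flats_iff)
  have "\<not> G \<subseteq> U"
  proof
    assume "G \<subseteq> U"
    then have "U = UNIV"
      using span_U span_G by (simp add: Int_absorb2)
    then show False
      using lower_flat(2) by simp
  qed
  then obtain g where new_direction: "g \<in> G" "g \<notin> U"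
    by blast
  let ?V = "span (insert g (G \<inter> U))"
  have "?V \<in> flats P"
    using new_direction(1) by (intro span_in_flats) blast
  moreover have "U \<subseteq> ?V"
    using span_mono[of "G \<inter> U" "insert g (G \<inter> U)"] span_U by auto
  moreover have "dim ?V = Suc (dim U)"
    using new_direction(2) dim_insert[of g "G \<inter> U"] dim_span[of "G \<inter> U"] by (simp add: span_U)
  ultimately show ?thesis by blast
qed

lemma poset_rank_lattice_of_flats:
  assumes "U \<in> flats P"
  shows "poset_rank (lattice_of_flats P) U = dim U"
proof (rule poset_rank_eq_rank_function)
  show "\<exists>V. (V, U) \<in> lattice_of_flats P \<and> dim U = Suc (dim V)"
    if "U \<in> Field (lattice_of_flats P)" "0 < dim U" for U
    using that flat_covers_flat by (auto simp: lattice_of_flats_iff)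
qed (use assms in \<open>auto simp: partial_order_on_flats
  finite_flats[OF polytope] intro: dim_flat_less\<close>)

lemma poset_rank_converse_lattice_of_flats:
  assumes UNIV_flat: "UNIV \<in> flats P" and "U \<in> flats P"
  shows "poset_rank ((lattice_of_flats P)\<inverse>) U = DIM('a) - dim U"
proof (rule poset_rank_eq_rank_function)
  show "DIM('a) - dim V < DIM('a) - dim U" if "(V, U) \<in> (lattice_of_flats P)\<inverse>" "V \<noteq> U" for U V
    using dim_flat_less[of U V P] that dim_subset_UNIV[of V] by auto
  show "\<exists>V. (V, U) \<in> (lattice_of_flats P)\<inverse> \<and> DIM('a) - dim U = Suc (DIM('a) - dim V)"
    if "U \<in> Field ((lattice_of_flats P)\<inverse>)" "0 < DIM('a) - dim U" for U
  proof -
    have lower_flat: "U \<in> flats P" "dim U < DIM('a)"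
      using that by simp_all
    then obtain V where "V \<in> flats P" "U \<subseteq> V" "dim V = Suc (dim U)"
      using flat_covered_by_flat[OF UNIV_flat] by blast
    then show ?thesis
      using lower_flat by (intro exI[of _ V]) (auto simp: lattice_of_flats_iff)
  qed
qed (use assms in \<open>auto simp: partial_order_on_flats finite_flats[OF polytope]\<close>)

theorem exterior_angle_sum_eq_whitney_second:
  assumes "cone_angle \<alpha>"
  shows "exterior_angle_sum \<alpha> i P = real (whitney_second (lattice_of_flats P) i)"
proof -
  have "exterior_angle_sum \<alpha> i P
      = (\<Sum>U | U \<in> flats P \<and> dim U = i. \<Sum>F\<in>parallel_faces P U. exterior_angle \<alpha> F P)"
    unfolding exterior_angle_sum_def by (rule sum_faces_of_dim_by_flats[OF polytope])
  also have "\<dots> = real (card {U. U \<in> flats P \<and> dim U = i})"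
    using exterior_angle_sum_parallel_faces[OF assms] by simp
  also have "{U. U \<in> flats P \<and> dim U = i}
      = {U \<in> Field (lattice_of_flats P). poset_rank (lattice_of_flats P) U = i}"
    by (auto simp: poset_rank_lattice_of_flats)
  finally show ?thesis
    by (simp add: whitney_second_def)
qed

lemma moebius_eq_interior_angle_sum:
  assumes angle: "cone_angle \<alpha>" and full: "aff_dim P = int DIM('a)" and flat: "U \<in> flats P"
  shows "real_of_int (moebius ((lattice_of_flats P)\<inverse>) UNIV U)
    = (-1) ^ (DIM('a) - dim U) * (\<Sum>F\<in>parallel_faces P U. interior_angle \<alpha> F P)"
proof (rule of_int_moebius_eqI)
  let ?r = "(lattice_of_flats P)\<inverse>"
  have convex: "convex P"
    using polytope by (rule polytope_imp_convex)
  have UNIV_flat: "UNIV \<in> flats P"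
    using UNIV_in_flats[OF convex full] .
  show "finite (Field ?r)" "Partial_order ?r" "(UNIV, U) \<in> ?r"
    using UNIV_flat flat finite_flats[OF polytope]
    by (simp_all add: partial_order_on_flats lattice_of_flats_iff)
  show "(-1) ^ (DIM('a) - dim (UNIV :: 'a set))
      * (\<Sum>F\<in>parallel_faces P UNIV. interior_angle \<alpha> F P) = 1"
    using parallel_faces_UNIV[OF convex full] interior_angle_self[OF angle polytope full] by simp
  fix V assume "(UNIV, V) \<in> ?r" "V \<noteq> UNIV"
  then have proper_flat: "V \<in> flats P" "V \<noteq> UNIV"
    by (simp_all add: lattice_of_flats_iff)
  have "(\<Sum>W | (UNIV, W) \<in> ?r \<and> (W, V) \<in> ?r.
        (-1) ^ (DIM('a) - dim W) * (\<Sum>F\<in>parallel_faces P W. interior_angle \<alpha> F P))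
      = (\<Sum>W | W \<in> flats P \<and> V \<subseteq> W. \<Sum>F\<in>parallel_faces P W.
          (-1) ^ (DIM('a) - dim (lin_space F)) * interior_angle \<alpha> F P)"
    using UNIV_flat proper_flat
    by (intro sum.cong) (auto simp: lattice_of_flats_iff parallel_faces_def sum_distrib_left)
  also have "\<dots> = 0"
    using alternating_sum_interior_angles[OF angle proper_flat]
    by (subst sum_faces_by_flats[OF polytope, symmetric])
  finally show "(\<Sum>W | (UNIV, W) \<in> ?r \<and> (W, V) \<in> ?r.
      (-1) ^ (DIM('a) - dim W) * (\<Sum>F\<in>parallel_faces P W. interior_angle \<alpha> F P)) = 0" .
qed

theorem interior_angle_sum_eq_whitney_first:
  assumes angle: "cone_angle \<alpha>" and full: "aff_dim P = int DIM('a)" and i_le: "i \<le> DIM('a)"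
  shows "interior_angle_sum \<alpha> i P
    = (-1) ^ (DIM('a) - i) * real_of_int (whitney_first ((lattice_of_flats P)\<inverse>) (DIM('a) - i))"
proof -
  let ?r = "(lattice_of_flats P)\<inverse>"
  have UNIV_flat: "UNIV \<in> flats P"
    using UNIV_in_flats[OF polytope_imp_convex[OF polytope] full] .
  have "DIM('a) - dim U = DIM('a) - i \<longleftrightarrow> dim U = i" for U :: "'a set"
    using i_le dim_subset_UNIV[of U] by linarith
  then have rank: "{U \<in> Field ?r. poset_rank ?r U = DIM('a) - i} = {U. U \<in> flats P \<and> dim U = i}"
    using poset_rank_converse_lattice_of_flats[OF UNIV_flat] by auto
  have "real_of_int (whitney_first ?r (DIM('a) - i))
      = (\<Sum>U | U \<in> flats P \<and> dim U = i. (-1) ^ (DIM('a) - i)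
          * (\<Sum>F\<in>parallel_faces P U. interior_angle \<alpha> F P))"
    unfolding whitney_first_def rank poset_bot_converse_lattice_of_flats[OF UNIV_flat]
    by (simp add: moebius_eq_interior_angle_sum[OF angle full])
  also have "\<dots> = (-1) ^ (DIM('a) - i) * interior_angle_sum \<alpha> i P"
    unfolding interior_angle_sum_def sum_faces_of_dim_by_flats[OF polytope] sum_distrib_left ..
  finally show ?thesis
    by (simp flip: mult.assoc power_add)
qed

end

theorem theorem1p2:
  fixes Z :: "(real ^ 'n) set" and \<alpha> :: "(real ^ 'n) set \<Rightarrow> real"
  assumes "zonotope Z" and "aff_dim Z = int CARD('n)" and "cone_angle \<alpha>"
  shows "\<forall>i<CARD('n).
    exterior_angle_sum \<alpha> i Z = real (whitney_second (lattice_of_flats Z) i) \<and>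
    interior_angle_sum \<alpha> i Z =
      (-1) ^ (CARD('n) - i) * real_of_int (whitney_first ((lattice_of_flats Z)\<inverse>) (CARD('n) - i))"
proof -
  obtain m :: nat and a b where Z_eq: "Z = (\<Sum>k<m. closed_segment (a k) (b k))"
    using assms(1) by (auto simp: zonotope_def)
  interpret belt_polytope Z "(\<lambda>k. b k - a k) ` {..<m}"
    unfolding Z_eq by (rule belt_polytope_sum_segments) simp
  show ?thesis
    using exterior_angle_sum_eq_whitney_second[OF assms(3)]
      interior_angle_sum_eq_whitney_first[OF assms(3)] assms(2)
    by simp
qed

end
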